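(* Let $\mathcal{A}$ be an abelian category and let $\mathcal{C}$ be a subcategory of $\mathcal{A}$ such that $\mathcal{C}\perp\mathcal{C}$ and $\mathcal{P}(\mathcal{A})$ is a generator for $\mathcal{C}$. Then: (1) $\mathcal{G}(\mathcal{C})^{\perp_1}$ is closed under direct products, direct summands and extensions. (2) $\mathcal{G}(\mathcal{C})^{\perp_1}$ is projectively resolving in $\mathcal{A}$. (3) $\mathcal{G}(\mathcal{C})^{\perp_1}$ is injectively coresolving in $\mathcal{A}$.
   Context: All subcategories of the abelian category $\mathcal{A}$ are full, additive and closed under isomorphisms. $\mathcal{P}(\mathcal{A})$ (resp. $\mathcal{I}(\mathcal{A})$) is the subcategory of projective (resp. injective) objects of $\mathcal{A}$. For subcategories $\mathcal{X},\mathcal{Y}$ of $\mathcal{A}$, $\mathcal{X}\perp\mathcal{Y}$ means $\mathrm{Ext}^{i}_{\mathcal{A}}(X,Y)=0$ for all $i\geq 1$, $X\in\mathcal{X}$, $Y\in\mathcal{Y}$. For subcategories $\mathcal{X}\subseteq\mathcal{T}$ of $\mathcal{A}$, $\mathcal{X}$ is a generator for $\mathcal{T}$ if for every $T\in\mathcal{T}$ there is an exact sequence $0\to T'\to X\to T\to 0$ in $\mathcal{A}$ with $X\in\mathcal{X}$ and $T'\in\mathcal{T}$ (in particular, $\mathcal{P}(\mathcal{A})$ being a generator for $\mathcal{C}$ includes $\mathcal{P}(\mathcal{A})\subseteq\mathcal{C}$). A sequence in $\mathcal{A}$ is $\mathrm{Hom}_{\mathcal{A}}(\mathcal{X},-)$-exact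 (resp. $\mathrm{Hom}_{\mathcal{A}}(-,\mathcal{X})$-exact) if it is exact after applying $\mathrm{Hom}_{\mathcal{A}}(X,-)$ (resp. $\mathrm{Hom}_{\mathcal{A}}(-,X)$) for every $X\in\mathcal{X}$. The Gorenstein subcategory $\mathcal{G}(\mathcal{C})$ consists of the objects $M$ of $\mathcal{A}$ for which there is an exact sequence $\cdots\to C_1\to C_0\to C^0\to C^1\to\cdots$ in $\mathcal{A}$ with all terms in $\mathcal{C}$, which is both $\mathrm{Hom}_{\mathcal{A}}(\mathcal{C},-)$-exact and $\mathrm{Hom}_{\mathcal{A}}(-,\mathcal{C})$-exact, such that $M\cong\mathrm{Im}(C_0\to C^0)$. $\mathcal{X}^{\perp_1}:=\{M\in\mathcal{A}\mid \mathrm{Ext}^1_{\mathcal{A}}(X,M)=0 \text{ for all } X\in\mathcal{X}\}$. A subcategory of $\mathcal{A}$ is projectively resolving if it contains $\mathcal{P}(\mathcal{A})$ and is closed under extensions and under kernels of epimorphisms; it is injectively coresolving if it contains $\mathcal{I}(\mathcal{A})$ and is closed under extensions and under cokernels of monomorphisms. *)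

theory Defs
  imports "HOL-Algebra.Coset"
begin

section \<open>Abelian categories\<close>

text \<open>
  \<open>Comp A g f\<close> is the composite ``g after f''. An arrow determines its domain and codomain,
  so hom-sets of distinct pairs of objects are disjoint; \<open>Plus A\<close> adds parallel arrows.
\<close>

record ('o, 'm) precat =
  Obj :: "'o set"
  Arr :: "'m set"
  Dom :: "'m \<Rightarrow> 'o"
  Cod :: "'m \<Rightarrow> 'o"
  Ident :: "'o \<Rightarrow> 'm"
  Comp :: "'m \<Rightarrow> 'm \<Rightarrow> 'm" (infixl "\<cdot>\<index>" 75)
  Plus :: "'m \<Rightarrow> 'm \<Rightarrow> 'm" (infixl "\<boxplus>\<index>" 65)
  ZeroArr :: "'o \<Rightarrow> 'o \<Rightarrow> 'm"

definition homs :: "('o, 'm, 'z) precat_scheme \<Rightarrow> 'o \<Rightarrow> 'o \<Rightarrow> 'm set" where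
  "homs A X Y = {f \<in> Arr A. Dom A f = X \<and> Cod A f = Y}"

definition hom_group :: "('o, 'm, 'z) precat_scheme \<Rightarrow> 'o \<Rightarrow> 'o \<Rightarrow> 'm monoid" where
  "hom_group A X Y = \<lparr>carrier = homs A X Y, mult = Plus A, one = ZeroArr A X Y\<rparr>"

locale category =
  fixes A :: "('o, 'm, 'z) precat_scheme" (structure)
  assumes Dom_closed: "f \<in> Arr A \<Longrightarrow> Dom A f \<in> Obj A"
    and Cod_closed: "f \<in> Arr A \<Longrightarrow> Cod A f \<in> Obj A"
    and Ident_closed: "X \<in> Obj A \<Longrightarrow> Ident A X \<in> homs A X X"
    and Comp_closed: "f \<in> homs A X Y \<Longrightarrow> g \<in> homs A Y Z \<Longrightarrow> g \<cdot> f \<in> homs A X Z"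
    and Ident_left: "f \<in> homs A X Y \<Longrightarrow> Ident A Y \<cdot> f = f"
    and Ident_right: "f \<in> homs A X Y \<Longrightarrow> f \<cdot> Ident A X = f"
    and Comp_assoc: "f \<in> homs A W X \<Longrightarrow> g \<in> homs A X Y \<Longrightarrow> h \<in> homs A Y Z \<Longrightarrow>
      (h \<cdot> g) \<cdot> f = h \<cdot> (g \<cdot> f)"

locale preadditive_category = category +
  assumes hom_comm_group: "X \<in> Obj A \<Longrightarrow> Y \<in> Obj A \<Longrightarrow> comm_group (hom_group A X Y)"
    and Comp_add_left: "f \<in> homs A X Y \<Longrightarrow> g \<in> homs A Y Z \<Longrightarrow> g' \<in> homs A Y Z \<Longrightarrow>
      (g \<boxplus> g') \<cdot> f = (g \<cdot> f) \<boxplus> (g' \<cdot> f)"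
    and Comp_add_right: "f \<in> homs A X Y \<Longrightarrow> f' \<in> homs A X Y \<Longrightarrow> g \<in> homs A Y Z \<Longrightarrow>
      g \<cdot> (f \<boxplus> f') = (g \<cdot> f) \<boxplus> (g \<cdot> f')"

definition monic :: "('o, 'm, 'z) precat_scheme \<Rightarrow> 'm \<Rightarrow> bool" where
  "monic A f \<longleftrightarrow> f \<in> Arr A \<and>
    (\<forall>W. \<forall>g\<in>homs A W (Dom A f). \<forall>h\<in>homs A W (Dom A f). Comp A f g = Comp A f h \<longrightarrow> g = h)"

definition epic :: "('o, 'm, 'z) precat_scheme \<Rightarrow> 'm \<Rightarrow> bool" where
  "epic A f \<longleftrightarrow> f \<in> Arr A \<and>
    (\<forall>W. \<forall>g\<in>homs A (Cod A f) W. \<forall>h\<in>homs A (Cod A f) W. Comp A g f = Comp A h f \<longrightarrow> g = h)"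

definition isomorphic :: "('o, 'm, 'z) precat_scheme \<Rightarrow> 'o \<Rightarrow> 'o \<Rightarrow> bool" where
  "isomorphic A X Y \<longleftrightarrow> X \<in> Obj A \<and> Y \<in> Obj A \<and>
    (\<exists>f\<in>homs A X Y. \<exists>g\<in>homs A Y X. Comp A g f = Ident A X \<and> Comp A f g = Ident A Y)"

definition is_zero_object :: "('o, 'm, 'z) precat_scheme \<Rightarrow> 'o \<Rightarrow> bool" where
  "is_zero_object A Z \<longleftrightarrow> Z \<in> Obj A \<and>
    (\<forall>X\<in>Obj A. (\<exists>!f. f \<in> homs A X Z) \<and> (\<exists>!f. f \<in> homs A Z X))"

definition is_biproduct ::
    "('o, 'm, 'z) precat_scheme \<Rightarrow> 'o \<Rightarrow> 'o \<Rightarrow> 'o \<Rightarrow> 'm \<Rightarrow> 'm \<Rightarrow> 'm \<Rightarrow> 'm \<Rightarrow> bool" where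
  "is_biproduct A X Y S i1 i2 p1 p2 \<longleftrightarrow>
    X \<in> Obj A \<and> Y \<in> Obj A \<and> S \<in> Obj A \<and>
    i1 \<in> homs A X S \<and> i2 \<in> homs A Y S \<and> p1 \<in> homs A S X \<and> p2 \<in> homs A S Y \<and>
    Comp A p1 i1 = Ident A X \<and> Comp A p2 i2 = Ident A Y \<and>
    Comp A p1 i2 = ZeroArr A Y X \<and> Comp A p2 i1 = ZeroArr A X Y \<and>
    Plus A (Comp A i1 p1) (Comp A i2 p2) = Ident A S"

definition is_direct_sum :: "('o, 'm, 'z) precat_scheme \<Rightarrow> 'o \<Rightarrow> 'o \<Rightarrow> 'o \<Rightarrow> bool" where
  "is_direct_sum A X Y S \<longleftrightarrow> (\<exists>i1 i2 p1 p2. is_biproduct A X Y S i1 i2 p1 p2)"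

definition is_kernel :: "('o, 'm, 'z) precat_scheme \<Rightarrow> 'm \<Rightarrow> 'm \<Rightarrow> bool" where
  "is_kernel A k f \<longleftrightarrow> k \<in> Arr A \<and> f \<in> Arr A \<and> Cod A k = Dom A f \<and>
    Comp A f k = ZeroArr A (Dom A k) (Cod A f) \<and>
    (\<forall>W. \<forall>g\<in>homs A W (Dom A f). Comp A f g = ZeroArr A W (Cod A f) \<longrightarrow>
      (\<exists>!u. u \<in> homs A W (Dom A k) \<and> Comp A k u = g))"

definition is_cokernel :: "('o, 'm, 'z) precat_scheme \<Rightarrow> 'm \<Rightarrow> 'm \<Rightarrow> bool" where
  "is_cokernel A c f \<longleftrightarrow> c \<in> Arr A \<and> f \<in> Arr A \<and> Dom A c = Cod A f \<and>
    Comp A c f = ZeroArr A (Dom A f) (Cod A c) \<and>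
    (\<forall>W. \<forall>g\<in>homs A (Cod A f) W. Comp A g f = ZeroArr A (Dom A f) W \<longrightarrow>
      (\<exists>!u. u \<in> homs A (Cod A c) W \<and> Comp A u c = g))"

locale abelian_category = preadditive_category +
  assumes zero_object: "\<exists>Z. is_zero_object A Z"
    and direct_sums: "X \<in> Obj A \<Longrightarrow> Y \<in> Obj A \<Longrightarrow> \<exists>S. is_direct_sum A X Y S"
    and kernels: "f \<in> Arr A \<Longrightarrow> \<exists>k. is_kernel A k f"
    and cokernels: "f \<in> Arr A \<Longrightarrow> \<exists>c. is_cokernel A c f"
    and monic_normal: "monic A f \<Longrightarrow> \<exists>g. is_kernel A f g"
    and epic_normal: "epic A f \<Longrightarrow> \<exists>g. is_cokernel A f g"

section \<open>Exactness, products, projective and injective objects\<close>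

text \<open>\<open>is_image A m f\<close>: the arrow \<open>m\<close> represents the subobject Im f = Ker (Coker f) of Cod f.\<close>

definition is_image :: "('o, 'm, 'z) precat_scheme \<Rightarrow> 'm \<Rightarrow> 'm \<Rightarrow> bool" where
  "is_image A m f \<longleftrightarrow> (\<exists>c. is_cokernel A c f \<and> is_kernel A m c)"

definition exact_at :: "('o, 'm, 'z) precat_scheme \<Rightarrow> 'm \<Rightarrow> 'm \<Rightarrow> bool" where
  "exact_at A f g \<longleftrightarrow> f \<in> Arr A \<and> g \<in> Arr A \<and> Cod A f = Dom A g \<and>
    (\<exists>m. is_image A m f \<and> is_kernel A m g)"

definition short_exact :: "('o, 'm, 'z) precat_scheme \<Rightarrow> 'm \<Rightarrow> 'm \<Rightarrow> bool" where
  "short_exact A f g \<longleftrightarrow> monic A f \<and> exact_at A f g \<and> epic A g"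

definition is_product ::
    "('o, 'm, 'z) precat_scheme \<Rightarrow> 'i set \<Rightarrow> ('i \<Rightarrow> 'o) \<Rightarrow> 'o \<Rightarrow> ('i \<Rightarrow> 'm) \<Rightarrow> bool" where
  "is_product A I M P p \<longleftrightarrow> P \<in> Obj A \<and> (\<forall>i\<in>I. M i \<in> Obj A \<and> p i \<in> homs A P (M i)) \<and>
    (\<forall>X\<in>Obj A. \<forall>f. (\<forall>i\<in>I. f i \<in> homs A X (M i)) \<longrightarrow>
      (\<exists>!u. u \<in> homs A X P \<and> (\<forall>i\<in>I. Comp A (p i) u = f i)))"

definition projectives :: "('o, 'm, 'z) precat_scheme \<Rightarrow> 'o set" where
  "projectives A = {P \<in> Obj A. \<forall>e. epic A e \<longrightarrow>
    (\<forall>f\<in>homs A P (Cod A e). \<exists>g\<in>homs A P (Dom A e). Comp A e g = f)}"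

definition injectives :: "('o, 'm, 'z) precat_scheme \<Rightarrow> 'o set" where
  "injectives A = {J \<in> Obj A. \<forall>m. monic A m \<longrightarrow>
    (\<forall>f\<in>homs A (Dom A m) J. \<exists>g\<in>homs A (Cod A m) J. Comp A g m = f)}"

section \<open>Yoneda Ext\<close>

text \<open>
  The category need not have enough projectives or injectives, so Ext is Yoneda's. An n-extension
  0 \<open>\<rightarrow>\<close> Y \<open>\<rightarrow>\<close> E1 \<open>\<rightarrow>\<close> ... \<open>\<rightarrow>\<close> En \<open>\<rightarrow>\<close> X \<open>\<rightarrow>\<close> 0 (for n at least 1) is represented by the list of its
  n + 1 arrows from Y to X. A morphism of n-extensions is a chain map with identities at both ends;
  two n-extensions are equivalent if a zigzag of such morphisms connects them.
\<close>

definition yoneda_extensions ::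
    "('o, 'm, 'z) precat_scheme \<Rightarrow> nat \<Rightarrow> 'o \<Rightarrow> 'o \<Rightarrow> 'm list set" where
  "yoneda_extensions A n X Y = {fs. length fs = Suc n \<and>
    Dom A (fs ! 0) = Y \<and> Cod A (fs ! n) = X \<and>
    monic A (fs ! 0) \<and> (\<forall>i<n. exact_at A (fs ! i) (fs ! Suc i)) \<and> epic A (fs ! n)}"

definition yoneda_morphism ::
    "('o, 'm, 'z) precat_scheme \<Rightarrow> nat \<Rightarrow> 'o \<Rightarrow> 'o \<Rightarrow> ('m list \<times> 'm list) set" where
  "yoneda_morphism A n X Y = {(fs, gs).
    fs \<in> yoneda_extensions A n X Y \<and> gs \<in> yoneda_extensions A n X Y \<and>
    (\<exists>h :: nat \<Rightarrow> 'm. h 0 = Ident A Y \<and> h (Suc n) = Ident A X \<and>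
      (\<forall>i\<le>n. h i \<in> homs A (Dom A (fs ! i)) (Dom A (gs ! i)) \<and>
        Comp A (h (Suc i)) (fs ! i) = Comp A (gs ! i) (h i)))}"

definition yoneda_Ext ::
    "('o, 'm, 'z) precat_scheme \<Rightarrow> nat \<Rightarrow> 'o \<Rightarrow> 'o \<Rightarrow> 'm list set set" where
  "yoneda_Ext A n X Y =
    yoneda_extensions A n X Y // (yoneda_morphism A n X Y \<union> (yoneda_morphism A n X Y)\<inverse>)\<^sup>*"

text \<open>
  \<open>yoneda_Ext A n X Y\<close> is the underlying set of the group Ext; as for any group, the group is zero
  exactly when this set has a single element. The Baer sum is therefore not needed.
\<close>

definition Ext_zero :: "('o, 'm, 'z) precat_scheme \<Rightarrow> nat \<Rightarrow> 'o \<Rightarrow> 'o \<Rightarrow> bool" where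
  "Ext_zero A n X Y \<longleftrightarrow> is_singleton (yoneda_Ext A n X Y)"

section \<open>Subcategories\<close>

text \<open>A full subcategory is given by its set of objects.\<close>

definition subcategory :: "('o, 'm, 'z) precat_scheme \<Rightarrow> 'o set \<Rightarrow> bool" where
  "subcategory A S \<longleftrightarrow> S \<subseteq> Obj A \<and>
    (\<forall>X Y. X \<in> S \<and> isomorphic A X Y \<longrightarrow> Y \<in> S) \<and>
    (\<exists>Z\<in>S. is_zero_object A Z) \<and>
    (\<forall>X\<in>S. \<forall>Y\<in>S. \<forall>T. is_direct_sum A X Y T \<longrightarrow> T \<in> S)"

definition Ext_orthogonal :: "('o, 'm, 'z) precat_scheme \<Rightarrow> 'o set \<Rightarrow> 'o set \<Rightarrow> bool" where
  "Ext_orthogonal A S T \<longleftrightarrow> (\<forall>i\<ge>1. \<forall>X\<in>S. \<forall>Y\<in>T. Ext_zero A i X Y)"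

definition right_perp1 :: "('o, 'm, 'z) precat_scheme \<Rightarrow> 'o set \<Rightarrow> 'o set" where
  "right_perp1 A S = {M \<in> Obj A. \<forall>X\<in>S. Ext_zero A 1 X M}"

definition generator_for :: "('o, 'm, 'z) precat_scheme \<Rightarrow> 'o set \<Rightarrow> 'o set \<Rightarrow> bool" where
  "generator_for A S T \<longleftrightarrow> S \<subseteq> T \<and>
    (\<forall>Y\<in>T. \<exists>f g. short_exact A f g \<and> Dom A f \<in> T \<and> Cod A f \<in> S \<and> Cod A g = Y)"

text \<open>
  Products are not assumed to exist in the category: every product that does exist, of a family
  indexed by a set of elements of the type \<open>'i\<close>, is considered.
\<close>

definition closed_under_products ::
    "'i itself \<Rightarrow> ('o, 'm, 'z) precat_scheme \<Rightarrow> 'o set \<Rightarrow> bool" where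
  "closed_under_products (_ :: 'i itself) A S \<longleftrightarrow>
    (\<forall>(I :: 'i set) M P p. is_product A I M P p \<and> (\<forall>i\<in>I. M i \<in> S) \<longrightarrow> P \<in> S)"

definition closed_under_summands :: "('o, 'm, 'z) precat_scheme \<Rightarrow> 'o set \<Rightarrow> bool" where
  "closed_under_summands A S \<longleftrightarrow> (\<forall>X Y T. is_direct_sum A X Y T \<and> T \<in> S \<longrightarrow> X \<in> S)"

definition closed_under_extensions :: "('o, 'm, 'z) precat_scheme \<Rightarrow> 'o set \<Rightarrow> bool" where
  "closed_under_extensions A S \<longleftrightarrow>
    (\<forall>f g. short_exact A f g \<and> Dom A f \<in> S \<and> Cod A g \<in> S \<longrightarrow> Cod A f \<in> S)"

definition closed_under_kernels_of_epis :: "('o, 'm, 'z) precat_scheme \<Rightarrow> 'o set \<Rightarrow> bool" where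
  "closed_under_kernels_of_epis A S \<longleftrightarrow>
    (\<forall>k g. epic A g \<and> is_kernel A k g \<and> Dom A g \<in> S \<and> Cod A g \<in> S \<longrightarrow> Dom A k \<in> S)"

definition closed_under_cokernels_of_monos :: "('o, 'm, 'z) precat_scheme \<Rightarrow> 'o set \<Rightarrow> bool" where
  "closed_under_cokernels_of_monos A S \<longleftrightarrow>
    (\<forall>f c. monic A f \<and> is_cokernel A c f \<and> Dom A f \<in> S \<and> Cod A f \<in> S \<longrightarrow> Cod A c \<in> S)"

definition projectively_resolving :: "('o, 'm, 'z) precat_scheme \<Rightarrow> 'o set \<Rightarrow> bool" where
  "projectively_resolving A S \<longleftrightarrow> subcategory A S \<and> projectives A \<subseteq> S \<and>
    closed_under_extensions A S \<and> closed_under_kernels_of_epis A S"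

definition injectively_coresolving :: "('o, 'm, 'z) precat_scheme \<Rightarrow> 'o set \<Rightarrow> bool" where
  "injectively_coresolving A S \<longleftrightarrow> subcategory A S \<and> injectives A \<subseteq> S \<and>
    closed_under_extensions A S \<and> closed_under_cokernels_of_monos A S"

section \<open>The Gorenstein subcategory\<close>

text \<open>
  Exactness at the middle term of the sequence of abelian groups obtained from f, g by applying
  Hom(X, -), respectively Hom(-, X); \<open>kernel\<close> is the kernel of a map of groups.
\<close>

definition Hom_from_exact_at :: "('o, 'm, 'z) precat_scheme \<Rightarrow> 'o \<Rightarrow> 'm \<Rightarrow> 'm \<Rightarrow> bool" where
  "Hom_from_exact_at A X f g \<longleftrightarrow>
    Comp A f ` homs A X (Dom A f) =
      kernel (hom_group A X (Dom A g)) (hom_group A X (Cod A g)) (Comp A g)"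

definition Hom_into_exact_at :: "('o, 'm, 'z) precat_scheme \<Rightarrow> 'o \<Rightarrow> 'm \<Rightarrow> 'm \<Rightarrow> bool" where
  "Hom_into_exact_at A X f g \<longleftrightarrow>
    (\<lambda>h. Comp A h g) ` homs A (Cod A g) X =
      kernel (hom_group A (Cod A f) X) (hom_group A (Dom A f) X) (\<lambda>h. Comp A h f)"

text \<open>
  The doubly infinite sequence is indexed by the integers so that \<open>d 0\<close> is the arrow from
  \<open>C\<^sub>0\<close> to \<open>C\<^sup>0\<close>; thus \<open>C\<^sub>n\<close> is \<open>Dom A (d (- n))\<close> and \<open>C\<^sup>n\<close> is \<open>Cod A (d n)\<close>.
\<close>

definition Gorenstein_sequence :: "('o, 'm, 'z) precat_scheme \<Rightarrow> 'o set \<Rightarrow> (int \<Rightarrow> 'm) \<Rightarrow> bool" where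
  "Gorenstein_sequence A C d \<longleftrightarrow>
    (\<forall>n. Dom A (d n) \<in> C) \<and>
    (\<forall>n. exact_at A (d n) (d (n + 1))) \<and>
    (\<forall>X\<in>C. \<forall>n. Hom_from_exact_at A X (d n) (d (n + 1))) \<and>
    (\<forall>X\<in>C. \<forall>n. Hom_into_exact_at A X (d n) (d (n + 1)))"

definition Gorenstein :: "('o, 'm, 'z) precat_scheme \<Rightarrow> 'o set \<Rightarrow> 'o set" where
  "Gorenstein A C = {M \<in> Obj A. \<exists>d m. Gorenstein_sequence A C d \<and>
    is_image A m (d 0) \<and> isomorphic A M (Dom A m)}"

end

theory Submission
  imports Defs
begin

text \<open>
  The hypotheses force \<open>C\<close> to be the class of projective objects: the exact sequence
  \<open>0 \<rightarrow> C' \<rightarrow> P \<rightarrow> Y \<rightarrow> 0\<close> given by the generator condition splits as \<open>Ext\<^sup>1(Y, C') = 0\<close>. Hence every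
  Gorenstein object \<open>X\<close> has sequences \<open>0 \<rightarrow> K \<rightarrow> P \<rightarrow> X \<rightarrow> 0\<close> and \<open>0 \<rightarrow> X \<rightarrow> P' \<rightarrow> Z \<rightarrow> 0\<close> with
  \<open>K\<close>, \<open>Z\<close> Gorenstein and \<open>P\<close>, \<open>P'\<close> projective. Therefore \<open>Ext\<^sup>1(X, M) = 0\<close> exactly when every arrow
  from \<open>K\<close> to \<open>M\<close> extends to \<open>P\<close>, and all closure properties become elementary lifting arguments;
  higher Ext groups are never used.
\<close>

text \<open>With Yoneda Ext there is no long exact sequence at hand, so each use of one is replaced
  by choosing a lift or extension and subtracting a correction term. The extension criterion is
  asymmetric: vanishing of Ext^1(X, M) extends arrows along any short exact sequence ending in
  \<open>X\<close> (by pushout), whereas the converse needs the middle term to be projective. Three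
  features of Gorenstein objects then feed the closure properties. The syzygy \<open>K\<close> is
  again Gorenstein, which replaces the dimension shift from Ext^2(X, L) to Ext^1(K, L) in the case
  of cokernels. The embedding of \<open>X\<close> in a projective with Gorenstein cokernel handles
  kernels of epimorphisms. Exactness under Hom(-, C) gives Ext^1(X, Q) = 0 for projective
  \<open>Q\<close>, which puts the projectives into the orthogonal class.\<close>

lemma is_singleton_quotient_iff:
  assumes "refl R" "sym R" "trans R" "a \<in> S"
  shows "is_singleton (S // R) \<longleftrightarrow> (\<forall>x\<in>S. (x, a) \<in> R)"
proof
  assume "is_singleton (S // R)"
  then obtain c where c: "S // R = {c}" unfolding is_singleton_def by blast
  show "\<forall>x\<in>S. (x, a) \<in> R"
  proof
    fix x assume "x \<in> S"
    then have "R `` {x} \<in> S // R" "R `` {a} \<in> S // R" using quotientI assms(4) by metis+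
    then have "R `` {x} = R `` {a}" unfolding c by simp
    moreover have "(a, a) \<in> R" using assms(1) by (rule refl_onD) simp
    ultimately show "(x, a) \<in> R" by blast
  qed
next
  assume *: "\<forall>x\<in>S. (x, a) \<in> R"
  have "R `` {x} = R `` {a}" if x: "x \<in> S" for x
  proof -
    have 1: "(x, a) \<in> R" using * x by simp
    have 2: "(a, x) \<in> R" using symD[OF assms(2) 1] .
    show ?thesis using transD[OF assms(3) 1] transD[OF assms(3) 2] by blast
  qed
  then have "c = R `` {a}" if "c \<in> S // R" for c using that quotientE by metis
  then have "S // R = {R `` {a}}" using quotientI[OF assms(4), of R] by blast
  then show "is_singleton (S // R)" by simp
qed

section \<open>Arithmetic of arrows\<close>

context category
begin

lemma homs_Obj: "f \<in> homs A X Y \<Longrightarrow> X \<in> Obj A \<and> Y \<in> Obj A"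
  using Dom_closed Cod_closed by (auto simp: homs_def)

lemma homs_eqs: "f \<in> homs A X Y \<Longrightarrow> f \<in> Arr A \<and> Dom A f = X \<and> Cod A f = Y"
  by (simp add: homs_def)

lemma monic_cancel:
  assumes "monic A m" "m \<in> homs A X Y" "f \<in> homs A W X" "g \<in> homs A W X" "m \<cdot> f = m \<cdot> g"
  shows "f = g"
  using assms unfolding monic_def homs_def by blast

lemma epic_cancel:
  assumes "epic A e" "e \<in> homs A X Y" "f \<in> homs A Y W" "g \<in> homs A Y W" "f \<cdot> e = g \<cdot> e"
  shows "f = g"
  using assms unfolding epic_def homs_def by blast

lemma monicI:
  assumes "m \<in> homs A X Y"
    and "\<And>W f g. f \<in> homs A W X \<Longrightarrow> g \<in> homs A W X \<Longrightarrow> m \<cdot> f = m \<cdot> g \<Longrightarrow> f = g"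
  shows "monic A m"
  using assms by (auto simp: monic_def homs_def)

lemma epicI:
  assumes "e \<in> homs A X Y"
    and "\<And>W f g. f \<in> homs A Y W \<Longrightarrow> g \<in> homs A Y W \<Longrightarrow> f \<cdot> e = g \<cdot> e \<Longrightarrow> f = g"
  shows "epic A e"
  using assms by (auto simp: epic_def homs_def)

lemma monic_comp:
  assumes "monic A m" "m \<in> homs A X Y" "monic A n" "n \<in> homs A W X"
  shows "monic A (m \<cdot> n)"
proof (rule monicI[OF Comp_closed[OF assms(4,2)]])
  fix V f g assume fg: "f \<in> homs A V W" "g \<in> homs A V W" "m \<cdot> n \<cdot> f = m \<cdot> n \<cdot> g"
  then have "m \<cdot> (n \<cdot> f) = m \<cdot> (n \<cdot> g)" using Comp_assoc assms by metis
  then have "n \<cdot> f = n \<cdot> g" using monic_cancel[OF assms(1,2)] Comp_closed assms(4) fg by metis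
  then show "f = g" using monic_cancel[OF assms(3,4)] fg by metis
qed

lemma epic_comp:
  assumes "epic A d" "d \<in> homs A X Y" "epic A e" "e \<in> homs A Y Z"
  shows "epic A (e \<cdot> d)"
proof (rule epicI[OF Comp_closed[OF assms(2,4)]])
  fix V f g assume fg: "f \<in> homs A Z V" "g \<in> homs A Z V" "f \<cdot> (e \<cdot> d) = g \<cdot> (e \<cdot> d)"
  then have "f \<cdot> e \<cdot> d = g \<cdot> e \<cdot> d" using Comp_assoc assms by metis
  then have "f \<cdot> e = g \<cdot> e" using epic_cancel[OF assms(1,2)] Comp_closed assms(4) fg by metis
  then show "f = g" using epic_cancel[OF assms(3,4)] fg by metis
qed

lemma epic_if_section:
  assumes "e \<in> homs A X Y" "s \<in> homs A Y X" "e \<cdot> s = Ident A Y"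
  shows "epic A e"
proof (rule epicI[OF assms(1)])
  fix V f g assume fg: "f \<in> homs A Y V" "g \<in> homs A Y V" "f \<cdot> e = g \<cdot> e"
  then have "f \<cdot> (e \<cdot> s) = g \<cdot> (e \<cdot> s)" using Comp_assoc assms by metis
  then show "f = g" using assms fg Ident_right by metis
qed

lemma monic_if_retraction:
  assumes "m \<in> homs A X Y" "r \<in> homs A Y X" "r \<cdot> m = Ident A X"
  shows "monic A m"
proof (rule monicI[OF assms(1)])
  fix V f g assume fg: "f \<in> homs A V X" "g \<in> homs A V X" "m \<cdot> f = m \<cdot> g"
  then have "r \<cdot> m \<cdot> f = r \<cdot> m \<cdot> g" using Comp_assoc assms by metis
  then show "f = g" using assms fg Ident_left by metis
qed

end

text \<open>The endpoints are read off from the second arrow, so that subtraction can be written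
  infix without naming a hom-set.\<close>

definition Minus :: "('o, 'm, 'z) precat_scheme \<Rightarrow> 'm \<Rightarrow> 'm \<Rightarrow> 'm" (infixl "\<boxminus>\<index>" 65) where
  "Minus A f g = Plus A f (m_inv (hom_group A (Dom A g) (Cod A g)) g)"

context preadditive_category
begin

lemma Plus_closed:
  assumes "f \<in> homs A X Y" "g \<in> homs A X Y" shows "f \<boxplus> g \<in> homs A X Y"
proof -
  interpret G: comm_group "hom_group A X Y" using homs_Obj[OF assms(1)] hom_comm_group by auto
  show ?thesis using G.m_closed assms by (simp add: hom_group_def)
qed

lemma Minus_closed:
  assumes "f \<in> homs A X Y" "g \<in> homs A X Y" shows "f \<boxminus> g \<in> homs A X Y"
proof -
  interpret G: comm_group "hom_group A X Y" using homs_Obj[OF assms(1)] hom_comm_group by auto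
  show ?thesis using G.m_closed[of f] G.inv_closed[of g] assms homs_eqs[OF assms(2)]
    by (simp add: hom_group_def Minus_def)
qed

lemma ZeroArr_closed:
  assumes "X \<in> Obj A" "Y \<in> Obj A" shows "ZeroArr A X Y \<in> homs A X Y"
proof -
  interpret G: comm_group "hom_group A X Y" using assms hom_comm_group by auto
  show ?thesis using G.one_closed by (simp add: hom_group_def)
qed

lemma Minus_Plus:
  assumes "f \<in> homs A X Y" "g \<in> homs A X Y" shows "(f \<boxminus> g) \<boxplus> g = f"
proof -
  interpret G: comm_group "hom_group A X Y" using homs_Obj[OF assms(1)] hom_comm_group by auto
  show ?thesis using G.m_assoc[of f "m_inv (hom_group A X Y) g" g] G.inv_closed[of g] G.l_inv[of g]
      G.r_one[of f] assms homs_eqs[OF assms(2)]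
    by (simp add: hom_group_def Minus_def)
qed

lemma Plus_right_cancel:
  assumes "f \<in> homs A X Y" "g \<in> homs A X Y" "h \<in> homs A X Y" "f \<boxplus> h = g \<boxplus> h" shows "f = g"
proof -
  interpret G: comm_group "hom_group A X Y" using homs_Obj[OF assms(1)] hom_comm_group by auto
  show ?thesis using G.right_cancel[of h f g] assms by (simp add: hom_group_def)
qed

lemma Zero_Plus:
  assumes "f \<in> homs A X Y" shows "ZeroArr A X Y \<boxplus> f = f"
proof -
  interpret G: comm_group "hom_group A X Y" using homs_Obj[OF assms(1)] hom_comm_group by auto
  show ?thesis using G.l_one[of f] assms by (simp add: hom_group_def)
qed

lemma Plus_Zero:
  assumes "f \<in> homs A X Y" shows "f \<boxplus> ZeroArr A X Y = f"
proof -
  interpret G: comm_group "hom_group A X Y" using homs_Obj[OF assms(1)] hom_comm_group by auto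
  show ?thesis using G.r_one[of f] assms by (simp add: hom_group_def)
qed

text \<open>Reduces subtraction to addition; from here on the group inverse is not unfolded
  again.\<close>

lemma Minus_eq_iff:
  assumes "f \<in> homs A X Y" "g \<in> homs A X Y" "h \<in> homs A X Y"
  shows "f \<boxminus> g = h \<longleftrightarrow> f = h \<boxplus> g"
  using assms Minus_Plus Plus_right_cancel Minus_closed by metis

lemma Minus_Zero:
  assumes "f \<in> homs A X Y" shows "f \<boxminus> ZeroArr A X Y = f"
  using assms Minus_eq_iff Plus_Zero ZeroArr_closed homs_Obj by metis

lemma Minus_eq_Zero_iff:
  assumes "f \<in> homs A X Y" "g \<in> homs A X Y"
  shows "f \<boxminus> g = ZeroArr A X Y \<longleftrightarrow> f = g"
  using assms Minus_eq_iff[of f X Y g] Zero_Plus[of g] ZeroArr_closed homs_Obj by metis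

lemma Comp_Zero_right:
  assumes "g \<in> homs A Y Z" "X \<in> Obj A"
  shows "g \<cdot> ZeroArr A X Y = ZeroArr A X Z"
proof -
  have o: "Y \<in> Obj A" "Z \<in> Obj A" using homs_Obj[OF assms(1)] by auto
  let ?z = "ZeroArr A X Y"
  have z: "?z \<in> homs A X Y" "g \<cdot> ?z \<in> homs A X Z" "ZeroArr A X Z \<in> homs A X Z"
    using o assms ZeroArr_closed Comp_closed by metis+
  have "g \<cdot> ?z \<boxplus> g \<cdot> ?z = ZeroArr A X Z \<boxplus> g \<cdot> ?z"
    using Comp_add_right[OF z(1) z(1) assms(1)] Zero_Plus z by metis
  then show ?thesis using Plus_right_cancel z by metis
qed

lemma Comp_Zero_left:
  assumes "f \<in> homs A X Y" "Z \<in> Obj A"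
  shows "ZeroArr A Y Z \<cdot> f = ZeroArr A X Z"
proof -
  have o: "Y \<in> Obj A" "X \<in> Obj A" using homs_Obj[OF assms(1)] by auto
  let ?z = "ZeroArr A Y Z"
  have z: "?z \<in> homs A Y Z" "?z \<cdot> f \<in> homs A X Z" "ZeroArr A X Z \<in> homs A X Z"
    using o assms ZeroArr_closed Comp_closed by metis+
  have "?z \<cdot> f \<boxplus> ?z \<cdot> f = ZeroArr A X Z \<boxplus> ?z \<cdot> f"
    using Comp_add_left[OF assms(1) z(1) z(1)] Zero_Plus z by metis
  then show ?thesis using Plus_right_cancel z by metis
qed

lemma Comp_Minus_right:
  assumes "f \<in> homs A X Y" "f' \<in> homs A X Y" "g \<in> homs A Y Z"
  shows "g \<cdot> (f \<boxminus> f') = (g \<cdot> f) \<boxminus> (g \<cdot> f')"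
  using Minus_eq_iff[of "g \<cdot> f" X Z "g \<cdot> f'" "g \<cdot> (f \<boxminus> f')"] assms
    Comp_add_right[OF Minus_closed[OF assms(1,2)] assms(2,3)] Minus_Plus Comp_closed Minus_closed
  by metis

lemma Comp_Minus_left:
  assumes "f \<in> homs A X Y" "g \<in> homs A Y Z" "g' \<in> homs A Y Z"
  shows "(g \<boxminus> g') \<cdot> f = (g \<cdot> f) \<boxminus> (g' \<cdot> f)"
  using Minus_eq_iff[of "g \<cdot> f" X Z "g' \<cdot> f" "(g \<boxminus> g') \<cdot> f"] assms
    Comp_add_left[OF assms(1) Minus_closed[OF assms(2,3)] assms(3)] Minus_Plus Comp_closed Minus_closed
  by metis

lemma monicI_Zero:
  assumes "m \<in> homs A X Y"
    and "\<And>W f. f \<in> homs A W X \<Longrightarrow> m \<cdot> f = ZeroArr A W Y \<Longrightarrow> f = ZeroArr A W X"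
  shows "monic A m"
proof (rule monicI[OF assms(1)])
  fix W f g assume *: "f \<in> homs A W X" "g \<in> homs A W X" "m \<cdot> f = m \<cdot> g"
  then have "m \<cdot> (f \<boxminus> g) = ZeroArr A W Y"
    using Comp_Minus_right[OF *(1,2) assms(1)] Minus_eq_Zero_iff Comp_closed assms(1) by metis
  then show "f = g" using assms(2)[OF Minus_closed] Minus_eq_Zero_iff * by metis
qed

lemma epicI_Zero:
  assumes "e \<in> homs A X Y"
    and "\<And>W f. f \<in> homs A Y W \<Longrightarrow> f \<cdot> e = ZeroArr A X W \<Longrightarrow> f = ZeroArr A Y W"
  shows "epic A e"
proof (rule epicI[OF assms(1)])
  fix W f g assume *: "f \<in> homs A Y W" "g \<in> homs A Y W" "f \<cdot> e = g \<cdot> e"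
  then have "(f \<boxminus> g) \<cdot> e = ZeroArr A X W"
    using Comp_Minus_left[OF assms(1) *(1,2)] Minus_eq_Zero_iff Comp_closed assms(1) by metis
  then show "f = g" using assms(2)[OF Minus_closed] Minus_eq_Zero_iff * by metis
qed

lemma monic_Zero:
  assumes "monic A m" "m \<in> homs A X Y" "f \<in> homs A W X" "m \<cdot> f = ZeroArr A W Y"
  shows "f = ZeroArr A W X"
  using monic_cancel[OF assms(1,2,3)] ZeroArr_closed Comp_Zero_right assms homs_Obj by metis

lemma epic_Zero:
  assumes "epic A e" "e \<in> homs A X Y" "f \<in> homs A Y W" "f \<cdot> e = ZeroArr A X W"
  shows "f = ZeroArr A Y W"
  using epic_cancel[OF assms(1,2,3)] ZeroArr_closed Comp_Zero_left assms homs_Obj by metis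

section \<open>Kernels, images and short exact sequences\<close>

lemma is_kernel_homs:
  "is_kernel A k f \<Longrightarrow> k \<in> homs A (Dom A k) (Dom A f) \<and> f \<in> homs A (Dom A f) (Cod A f)"
  by (simp add: is_kernel_def homs_def)

lemma is_cokernel_homs:
  "is_cokernel A c f \<Longrightarrow> f \<in> homs A (Dom A f) (Cod A f) \<and> c \<in> homs A (Cod A f) (Cod A c)"
  by (simp add: is_cokernel_def homs_def)

lemma kernel_monic:
  assumes "is_kernel A k f" shows "monic A k"
proof (rule monicI)
  show kh: "k \<in> homs A (Dom A k) (Dom A f)" using assms is_kernel_homs by auto
  have fh: "f \<in> homs A (Dom A f) (Cod A f)" using assms is_kernel_homs by auto
  fix W g h assume *: "g \<in> homs A W (Dom A k)" "h \<in> homs A W (Dom A k)" "k \<cdot> g = k \<cdot> h"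
  have fk: "f \<cdot> k = ZeroArr A (Dom A k) (Cod A f)" using assms by (simp add: is_kernel_def)
  have kg: "k \<cdot> g \<in> homs A W (Dom A f)" using * kh Comp_closed by metis
  have "f \<cdot> (k \<cdot> g) = ZeroArr A W (Cod A f)"
    using Comp_assoc[OF *(1) kh fh] fk Comp_Zero_left[OF *(1)] homs_Obj[OF fh] by metis
  then have "\<exists>!u. u \<in> homs A W (Dom A k) \<and> k \<cdot> u = k \<cdot> g"
    using assms kg by (simp add: is_kernel_def)
  then show "g = h" using * by metis
qed

lemma cokernel_epic:
  assumes "is_cokernel A c f" shows "epic A c"
proof (rule epicI)
  show ch: "c \<in> homs A (Cod A f) (Cod A c)" using assms is_cokernel_homs by auto
  have fh: "f \<in> homs A (Dom A f) (Cod A f)" using assms is_cokernel_homs by auto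
  fix W g h assume *: "g \<in> homs A (Cod A c) W" "h \<in> homs A (Cod A c) W" "g \<cdot> c = h \<cdot> c"
  have fk: "c \<cdot> f = ZeroArr A (Dom A f) (Cod A c)" using assms by (simp add: is_cokernel_def)
  have kg: "g \<cdot> c \<in> homs A (Cod A f) W" using * ch Comp_closed by metis
  have "g \<cdot> c \<cdot> f = ZeroArr A (Dom A f) W"
    using Comp_assoc[OF fh ch *(1)] fk Comp_Zero_right[OF *(1)] homs_Obj[OF fh] by metis
  then have "\<exists>!u. u \<in> homs A (Cod A c) W \<and> u \<cdot> c = g \<cdot> c"
    using assms kg by (simp add: is_cokernel_def)
  then show "g = h" using * by metis
qed

lemma kernel_zero:
  assumes "is_kernel A k f" "k \<in> homs A K X" "f \<in> homs A X Y"
  shows "f \<cdot> k = ZeroArr A K Y"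
  using assms by (auto simp: is_kernel_def homs_def)

lemma kernel_factor:
  assumes "is_kernel A k f" "k \<in> homs A K X" "f \<in> homs A X Y"
    and "g \<in> homs A W X" "f \<cdot> g = ZeroArr A W Y"
  obtains u where "u \<in> homs A W K" "k \<cdot> u = g"
proof -
  have "Dom A f = X" "Cod A f = Y" "Dom A k = K" using assms homs_eqs by metis+
  then have "\<exists>u. u \<in> homs A W K \<and> k \<cdot> u = g" using assms unfolding is_kernel_def by metis
  then show ?thesis using that by auto
qed

lemma cokernel_zero:
  assumes "is_cokernel A c f" "f \<in> homs A X Y" "c \<in> homs A Y Z"
  shows "c \<cdot> f = ZeroArr A X Z"
  using assms by (auto simp: is_cokernel_def homs_def)

lemma cokernel_factor:
  assumes "is_cokernel A c f" "f \<in> homs A X Y" "c \<in> homs A Y Z"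
    and "g \<in> homs A Y W" "g \<cdot> f = ZeroArr A X W"
  obtains u where "u \<in> homs A Z W" "u \<cdot> c = g"
proof -
  have "Dom A f = X" "Cod A f = Y" "Cod A c = Z" using assms homs_eqs by metis+
  then have "\<exists>u. u \<in> homs A Z W \<and> u \<cdot> c = g" using assms unfolding is_cokernel_def by metis
  then show ?thesis using that by auto
qed

text \<open>Uniqueness of the factorization is cancellation of the monic \<open>k\<close>, so
  existence alone is left to check.\<close>

lemma is_kernelI:
  assumes "k \<in> homs A K X" "f \<in> homs A X Y" "monic A k" "f \<cdot> k = ZeroArr A K Y"
    and "\<And>W g. g \<in> homs A W X \<Longrightarrow> f \<cdot> g = ZeroArr A W Y \<Longrightarrow> \<exists>u \<in> homs A W K. k \<cdot> u = g"
  shows "is_kernel A k f"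
proof -
  have e: "Dom A f = X" "Cod A f = Y" "Dom A k = K" "Cod A k = X" "k \<in> Arr A" "f \<in> Arr A"
    using assms homs_eqs by metis+
  have "\<exists>!u. u \<in> homs A W K \<and> k \<cdot> u = g" if g: "g \<in> homs A W X" "f \<cdot> g = ZeroArr A W Y" for W g
    using assms(5)[OF g] monic_cancel[OF assms(3,1)] by metis
  then show ?thesis using assms(4) by (simp add: is_kernel_def e)
qed

lemma is_cokernelI:
  assumes "f \<in> homs A X Y" "c \<in> homs A Y Z" "epic A c" "c \<cdot> f = ZeroArr A X Z"
    and "\<And>W g. g \<in> homs A Y W \<Longrightarrow> g \<cdot> f = ZeroArr A X W \<Longrightarrow> \<exists>u \<in> homs A Z W. u \<cdot> c = g"
  shows "is_cokernel A c f"
proof -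
  have e: "Dom A f = X" "Cod A f = Y" "Dom A c = Y" "Cod A c = Z" "c \<in> Arr A" "f \<in> Arr A"
    using assms homs_eqs by metis+
  have "\<exists>!u. u \<in> homs A Z W \<and> u \<cdot> c = g" if g: "g \<in> homs A Y W" "g \<cdot> f = ZeroArr A X W" for W g
    using assms(5)[OF g] epic_cancel[OF assms(3,2)] by metis
  then show ?thesis using assms(4) by (simp add: is_cokernel_def e)
qed

text \<open>A monic \<open>m\<close> does not change which arrows are killed. This allows a
  differential to be replaced by its corestriction to its image.\<close>

lemma kernel_comp_monic:
  assumes "is_kernel A k (m \<cdot> e)" "k \<in> homs A K X" "e \<in> homs A X Y" "m \<in> homs A Y Z" "monic A m"
  shows "is_kernel A k e"
proof (rule is_kernelI[OF assms(2,3)])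
  note me = Comp_closed[OF assms(3,4)]
  show "monic A k" using assms(1) kernel_monic by metis
  have "m \<cdot> (e \<cdot> k) = ZeroArr A K Z"
    using kernel_zero[OF assms(1,2) me] Comp_assoc assms by metis
  then show "e \<cdot> k = ZeroArr A K Y" using monic_Zero assms Comp_closed by metis
  fix W g assume g: "g \<in> homs A W X" "e \<cdot> g = ZeroArr A W Y"
  then have "m \<cdot> e \<cdot> g = ZeroArr A W Z"
    using Comp_assoc[OF g(1) assms(3,4)] Comp_Zero_right[OF assms(4)] homs_Obj by metis
  then show "\<exists>u\<in>homs A W K. k \<cdot> u = g" using kernel_factor[OF assms(1,2) me g(1)] by metis
qed

end

section \<open>Consequences of normality: short exact sequences and image factorization\<close>

context abelian_category
begin

text \<open>By normality \<open>m\<close> is the kernel of some \<open>h\<close>. As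
  \<open>h\<close> kills \<open>m\<close>, it factors through \<open>c\<close>, so whatever
  \<open>c\<close> kills is killed by \<open>h\<close> and hence factors through
  \<open>m\<close>.\<close>

lemma kernel_of_cokernel:
  assumes "monic A m" "is_cokernel A c m" shows "is_kernel A m c"
proof -
  let ?K = "Dom A m" and ?X = "Cod A m" and ?Z = "Cod A c"
  have mh: "m \<in> homs A ?K ?X" and ch: "c \<in> homs A ?X ?Z"
    using is_cokernel_homs[OF assms(2)] by auto
  obtain h where h: "is_kernel A m h" using monic_normal assms by metis
  have "Dom A h = ?X" using h by (simp add: is_kernel_def)
  then have hh: "h \<in> homs A ?X (Cod A h)" using is_kernel_homs[OF h] by auto
  obtain v where v: "v \<in> homs A ?Z (Cod A h)" "v \<cdot> c = h"
    using cokernel_factor[OF assms(2) mh ch hh kernel_zero[OF h mh hh]] by metis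
  show ?thesis
  proof (rule is_kernelI[OF mh ch assms(1) cokernel_zero[OF assms(2) mh ch]])
    fix W g assume g: "g \<in> homs A W ?X" "c \<cdot> g = ZeroArr A W ?Z"
    then have "h \<cdot> g = ZeroArr A W (Cod A h)"
      using Comp_assoc[OF g(1) ch v(1)] v(2) Comp_Zero_right[OF v(1)] homs_Obj by metis
    then show "\<exists>u\<in>homs A W ?K. m \<cdot> u = g" using kernel_factor[OF h mh hh g(1)] by metis
  qed
qed

lemma cokernel_of_kernel:
  assumes "epic A e" "is_kernel A k e" shows "is_cokernel A e k"
proof -
  let ?X = "Dom A e" and ?Y = "Cod A e" and ?K = "Dom A k"
  have kh: "k \<in> homs A ?K ?X" and eh: "e \<in> homs A ?X ?Y"
    using is_kernel_homs[OF assms(2)] by auto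
  obtain h where h: "is_cokernel A e h" using epic_normal assms by metis
  have "Cod A h = ?X" using h by (simp add: is_cokernel_def)
  then have hh: "h \<in> homs A (Dom A h) ?X" using is_cokernel_homs[OF h] by auto
  obtain v where v: "v \<in> homs A (Dom A h) ?K" "k \<cdot> v = h"
    using kernel_factor[OF assms(2) kh eh hh cokernel_zero[OF h hh eh]] by metis
  show ?thesis
  proof (rule is_cokernelI[OF kh eh assms(1) kernel_zero[OF assms(2) kh eh]])
    fix W g assume g: "g \<in> homs A ?X W" "g \<cdot> k = ZeroArr A ?K W"
    then have "g \<cdot> h = ZeroArr A (Dom A h) W"
      using Comp_assoc[OF v(1) kh g(1)] v(2) Comp_Zero_left[OF v(1)] homs_Obj by metis
    then show "\<exists>u\<in>homs A ?Y W. u \<cdot> e = g" using cokernel_factor[OF h hh eh g(1)] by metis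
  qed
qed

text \<open>Exactness speaks of some representative \<open>m\<close> of the image of
  \<open>k\<close>. As \<open>k\<close> is monic, \<open>k\<close> and \<open>m\<close> are both
  kernels of the same cokernel \<open>c\<close> and factor through each other (\<open>u\<close> and
  \<open>v\<close>), so \<open>k\<close> inherits from \<open>m\<close> the property of being a
  kernel of \<open>e\<close>. In the converse direction \<open>k\<close> serves as its own
  image.\<close>

lemma short_exact_iff_kernel: "short_exact A k e \<longleftrightarrow> is_kernel A k e \<and> epic A e"
proof
  assume *: "short_exact A k e"
  then obtain m c where m: "is_cokernel A c k" "is_kernel A m c" "is_kernel A m e" and ke: "monic A k" "epic A e"
      and co: "Cod A k = Dom A e"
    unfolding short_exact_def exact_at_def is_image_def by auto
  have k: "is_kernel A k c" using kernel_of_cokernel ke m by metis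
  let ?X = "Dom A e" and ?Y = "Cod A e" and ?K = "Dom A k" and ?M = "Dom A m" and ?C = "Cod A c"
  have eh: "e \<in> homs A ?X ?Y" and mh: "m \<in> homs A ?M ?X" using is_kernel_homs[OF m(3)] by auto
  have kh: "k \<in> homs A ?K ?X" and ch: "c \<in> homs A ?X ?C" using is_cokernel_homs[OF m(1)] co by auto
  obtain u where u: "u \<in> homs A ?K ?M" "m \<cdot> u = k"
    using kernel_factor[OF m(2) mh ch kh] kernel_zero[OF k kh ch] by metis
  obtain v where v: "v \<in> homs A ?M ?K" "k \<cdot> v = m"
    using kernel_factor[OF k kh ch mh] kernel_zero[OF m(2) mh ch] by metis
  have "is_kernel A k e"
  proof (rule is_kernelI[OF kh eh ke(1)])
    show "e \<cdot> k = ZeroArr A ?K ?Y"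
      using Comp_assoc[OF u(1) mh eh] kernel_zero[OF m(3) mh eh] u Comp_Zero_left homs_Obj eh by metis
    fix W g assume g: "g \<in> homs A W ?X" "e \<cdot> g = ZeroArr A W ?Y"
    obtain w where w: "w \<in> homs A W ?M" "m \<cdot> w = g" using kernel_factor[OF m(3) mh eh g] by metis
    then have "v \<cdot> w \<in> homs A W ?K" "k \<cdot> (v \<cdot> w) = g"
      using Comp_closed v Comp_assoc[OF w(1) v(1) kh] by metis+
    then show "\<exists>u\<in>homs A W ?K. k \<cdot> u = g" by blast
  qed
  then show "is_kernel A k e \<and> epic A e" using ke by simp
next
  assume *: "is_kernel A k e \<and> epic A e"
  then have m: "monic A k" using kernel_monic by metis
  obtain c where c: "is_cokernel A c k" using cokernels m unfolding monic_def by blast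
  have "is_image A k k" unfolding is_image_def using kernel_of_cokernel m c by metis
  then show "short_exact A k e"
    unfolding short_exact_def exact_at_def using * m by (auto simp: is_kernel_def)
qed

lemma short_exact_iff_cokernel: "short_exact A k e \<longleftrightarrow> is_cokernel A e k \<and> monic A k"
  using short_exact_iff_kernel cokernel_of_kernel kernel_of_cokernel kernel_monic cokernel_epic
  by metis

text \<open>The image is the smallest subobject through which \<open>f\<close> factors, and this
  makes \<open>e\<close> epic. If \<open>z\<close> kills \<open>e\<close>, then \<open>e\<close>
  factors through the kernel \<open>n\<close> of \<open>z\<close>, hence \<open>f\<close> through
  the monic \<open>m \<cdot> n\<close>. The cokernel of \<open>m \<cdot> n\<close> then kills
  \<open>f\<close>, so it factors through \<open>c\<close> and kills \<open>m\<close>. Thus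
  \<open>m\<close> factors through \<open>m \<cdot> n\<close>, which gives \<open>n\<close> a
  section, and \<open>z\<close> vanishes.\<close>

lemma image_factor:
  assumes "is_image A m f" "f \<in> homs A X Y" "m \<in> homs A I Y"
  obtains e where "e \<in> homs A X I" "m \<cdot> e = f" "epic A e" "monic A m"
proof -
  obtain c where c: "is_cokernel A c f" "is_kernel A m c" using assms by (auto simp: is_image_def)
  let ?C = "Cod A c"
  have ch: "c \<in> homs A Y ?C" using is_cokernel_homs[OF c(1)] homs_eqs[OF assms(2)] by metis
  have mm: "monic A m" using kernel_monic c by metis
  obtain e where e: "e \<in> homs A X I" "m \<cdot> e = f"
    using kernel_factor[OF c(2) assms(3) ch assms(2) cokernel_zero[OF c(1) assms(2) ch]] by metis
  have "epic A e"
  proof (rule epicI_Zero[OF e(1)])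
    fix W z assume z: "z \<in> homs A I W" "z \<cdot> e = ZeroArr A X W"
    obtain n where n: "is_kernel A n z" using kernels homs_eqs[OF z(1)] by metis
    let ?N = "Dom A n"
    have nh: "n \<in> homs A ?N I" using is_kernel_homs[OF n] homs_eqs[OF z(1)] by metis
    have nm: "monic A n" using kernel_monic n by metis
    obtain e' where e': "e' \<in> homs A X ?N" "n \<cdot> e' = e" using kernel_factor[OF n nh z(1) e(1) z(2)] by metis
    have mn: "monic A (m \<cdot> n)" "m \<cdot> n \<in> homs A ?N Y"
      using monic_comp[OF mm assms(3) nm nh] Comp_closed[OF nh assms(3)] by auto
    obtain c' where c': "is_cokernel A c' (m \<cdot> n)" using cokernels homs_eqs[OF mn(2)] by metis
    let ?C' = "Cod A c'"
    have ch': "c' \<in> homs A Y ?C'" using is_cokernel_homs[OF c'] homs_eqs[OF mn(2)] by metis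
    note k = kernel_of_cokernel[OF mn(1) c']
    have f: "f = m \<cdot> n \<cdot> e'" using Comp_assoc[OF e'(1) nh assms(3)] e e' by metis
    have "c' \<cdot> f = ZeroArr A X ?C'"
      unfolding f using Comp_assoc[OF e'(1) mn(2) ch'] kernel_zero[OF k mn(2) ch'] Comp_Zero_left[OF e'(1)]
        homs_Obj[OF ch'] by metis
    then obtain v where v: "v \<in> homs A ?C ?C'" "v \<cdot> c = c'"
      using cokernel_factor[OF c(1) assms(2) ch ch'] by metis
    have "c' \<cdot> m = ZeroArr A I ?C'"
      using Comp_assoc[OF assms(3) ch v(1)] v kernel_zero[OF c(2) assms(3) ch] Comp_Zero_right[OF v(1)]
        homs_Obj[OF assms(3)] by metis
    then obtain w where w: "w \<in> homs A I ?N" "m \<cdot> n \<cdot> w = m" using kernel_factor[OF k mn(2) ch' assms(3)] by metis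
    have I: "I \<in> Obj A" using homs_Obj nh by metis
    have "m \<cdot> (n \<cdot> w) = m \<cdot> Ident A I"
      using Comp_assoc[OF w(1) nh assms(3)] w(2) Ident_right[OF assms(3)] by metis
    then have nw: "n \<cdot> w = Ident A I"
      using monic_cancel[OF mm assms(3)] Comp_closed[OF w(1) nh] Ident_closed[OF I] by metis
    show "z = ZeroArr A I W"
      using Comp_assoc[OF w(1) nh z(1)] nw Ident_right[OF z(1)] kernel_zero[OF n nh z(1)]
        Comp_Zero_left[OF w(1)] homs_Obj[OF z(1)] by metis
  qed
  then show ?thesis using that e mm by metis
qed

lemma short_exact_homs:
  assumes "short_exact A k e"
  shows "k \<in> homs A (Dom A k) (Cod A k) \<and> e \<in> homs A (Cod A k) (Cod A e)"
  using assms is_cokernel_homs[of e k] short_exact_iff_cokernel by metis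

lemma short_exactD:
  assumes "short_exact A k e" "k \<in> homs A K P" "e \<in> homs A P G"
  shows "monic A k" "epic A e" "e \<cdot> k = ZeroArr A K G" "is_kernel A k e" "is_cokernel A e k"
proof -
  show *: "is_kernel A k e" "epic A e" "is_cokernel A e k" "monic A k"
    using assms(1) short_exact_iff_kernel short_exact_iff_cokernel by auto
  show "e \<cdot> k = ZeroArr A K G" using kernel_zero *(1) assms by metis
qed

section \<open>Splittings of short exact sequences\<close>

lemma section_if_retraction:
  assumes "short_exact A k e" "k \<in> homs A K P" "e \<in> homs A P G"
    and r: "r \<in> homs A P K" "r \<cdot> k = Ident A K"
  shows "\<exists>s \<in> homs A G P. e \<cdot> s = Ident A G"
proof -
  note ke = short_exactD[OF assms(1-3)]
  have o: "P \<in> Obj A" "G \<in> Obj A" "K \<in> Obj A" using homs_Obj assms by metis+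
  note iP = Ident_closed[OF o(1)] note iG = Ident_closed[OF o(2)]
  have kr: "k \<cdot> r \<in> homs A P P" using Comp_closed r assms by metis
  \<comment> \<open>The projection along the image of \<open>k\<close>: it kills \<open>k\<close>,
    so it descends along the cokernel \<open>e\<close>, and the arrow obtained is the
    section.\<close>
  let ?t = "Ident A P \<boxminus> k \<cdot> r"
  have t: "?t \<in> homs A P P" using Minus_closed[OF iP kr] .
  have "k \<cdot> r \<cdot> k = k" using Comp_assoc[OF assms(2) r(1) assms(2)] r(2) Ident_right assms(2) by metis
  then have "?t \<cdot> k = ZeroArr A K P"
    using Comp_Minus_left[OF assms(2) iP kr] Ident_left[OF assms(2)] Minus_eq_Zero_iff[OF assms(2) assms(2)]
    by metis
  then obtain s where s: "s \<in> homs A G P" "s \<cdot> e = ?t"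
    using cokernel_factor[OF ke(5) assms(2,3) t] by metis
  have "e \<cdot> (k \<cdot> r) = ZeroArr A P G"
    using Comp_assoc[OF r(1) assms(2,3)] ke(3) Comp_Zero_left[OF r(1) o(2)] by metis
  then have "e \<cdot> ?t = e"
    using Comp_Minus_right[OF iP kr assms(3)] Ident_right[OF assms(3)] Minus_Zero[OF assms(3)] by metis
  then have "e \<cdot> s \<cdot> e = Ident A G \<cdot> e"
    using Comp_assoc[OF assms(3) s(1) assms(3)] s(2) Ident_left[OF assms(3)] by metis
  then have "e \<cdot> s = Ident A G"
    using epic_cancel[OF ke(2) assms(3)] Comp_closed[OF s(1) assms(3)] iG by metis
  then show ?thesis using s by auto
qed

text \<open>Dual argument: the identity minus \<open>s \<cdot> e\<close> is killed by
  \<open>e\<close>, so it factors through the kernel \<open>k\<close>, and the factor is the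
  retraction.\<close>

lemma retraction_if_section:
  assumes "short_exact A k e" "k \<in> homs A K P" "e \<in> homs A P G"
    and s: "s \<in> homs A G P" "e \<cdot> s = Ident A G"
  shows "\<exists>r \<in> homs A P K. r \<cdot> k = Ident A K"
proof -
  note ke = short_exactD[OF assms(1-3)]
  have o: "P \<in> Obj A" "G \<in> Obj A" "K \<in> Obj A" using homs_Obj assms by metis+
  note iP = Ident_closed[OF o(1)] note iK = Ident_closed[OF o(3)]
  have se: "s \<cdot> e \<in> homs A P P" using Comp_closed s assms by metis
  let ?t = "Ident A P \<boxminus> s \<cdot> e"
  have t: "?t \<in> homs A P P" using Minus_closed[OF iP se] .
  have "e \<cdot> (s \<cdot> e) = e" using Comp_assoc[OF assms(3) s(1) assms(3)] s(2) Ident_left assms(3) by metis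
  then have "e \<cdot> ?t = ZeroArr A P G"
    using Comp_Minus_right[OF iP se assms(3)] Ident_right[OF assms(3)] Minus_eq_Zero_iff[OF assms(3) assms(3)]
    by metis
  then obtain r where r: "r \<in> homs A P K" "k \<cdot> r = ?t"
    using kernel_factor[OF ke(4) assms(2,3) t] by metis
  have "s \<cdot> e \<cdot> k = ZeroArr A K P"
    using Comp_assoc[OF assms(2,3) s(1)] ke(3) Comp_Zero_right[OF s(1) o(3)] by metis
  then have "?t \<cdot> k = k"
    using Comp_Minus_left[OF assms(2) iP se] Ident_left[OF assms(2)] Minus_Zero[OF assms(2)] by metis
  then have "k \<cdot> (r \<cdot> k) = k \<cdot> Ident A K"
    using Comp_assoc[OF assms(2) r(1) assms(2)] r(2) Ident_right[OF assms(2)] by metis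
  then have "r \<cdot> k = Ident A K"
    using monic_cancel[OF ke(1) assms(2)] Comp_closed[OF assms(2) r(1)] iK by metis
  then show ?thesis using r by auto
qed

lemma biproduct_short_exact:
  assumes "is_biproduct A X Y S i1 i2 p1 p2"
  shows "short_exact A i1 p2"
proof -
  have h: "i1 \<in> homs A X S" "i2 \<in> homs A Y S" "p1 \<in> homs A S X" "p2 \<in> homs A S Y"
    and e: "p1 \<cdot> i1 = Ident A X" "p2 \<cdot> i2 = Ident A Y" "p1 \<cdot> i2 = ZeroArr A Y X" "p2 \<cdot> i1 = ZeroArr A X Y"
      "i1 \<cdot> p1 \<boxplus> i2 \<cdot> p2 = Ident A S"
    using assms by (auto simp: is_biproduct_def)
  have "is_kernel A i1 p2"
  proof (rule is_kernelI[OF h(1,4) monic_if_retraction[OF h(1,3) e(1)] e(4)])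
    fix W g assume g: "g \<in> homs A W S" "p2 \<cdot> g = ZeroArr A W Y"
    have ip: "i1 \<cdot> p1 \<in> homs A S S" "i2 \<cdot> p2 \<in> homs A S S" using Comp_closed h by metis+
    have pg: "p1 \<cdot> g \<in> homs A W X" "i1 \<cdot> (p1 \<cdot> g) \<in> homs A W S" using Comp_closed h g by metis+
    have "i2 \<cdot> p2 \<cdot> g = ZeroArr A W S"
      using Comp_assoc[OF g(1) h(4,2)] g(2) Comp_Zero_right[OF h(2)] homs_Obj[OF g(1)] by metis
    moreover have "i1 \<cdot> p1 \<cdot> g = i1 \<cdot> (p1 \<cdot> g)" using Comp_assoc[OF g(1) h(3,1)] .
    ultimately have "g = i1 \<cdot> (p1 \<cdot> g)"
      using Comp_add_left[OF g(1) ip] e(5) Ident_left[OF g(1)] Plus_Zero[OF pg(2)] by metis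
    then show "\<exists>u\<in>homs A W X. i1 \<cdot> u = g" using pg by metis
  qed
  then show ?thesis using epic_if_section[OF h(4,2) e(2)] short_exact_iff_kernel by simp
qed

section \<open>Extensions and Ext\<close>

lemma yoneda_extensions_1:
  "fs \<in> yoneda_extensions A 1 X Y \<longleftrightarrow>
    (\<exists>k e. fs = [k, e] \<and> short_exact A k e \<and> Dom A k = Y \<and> Cod A e = X)"
proof
  assume *: "fs \<in> yoneda_extensions A 1 X Y"
  then obtain k e where "fs = [k, e]"
    unfolding yoneda_extensions_def by (auto simp: length_Suc_conv)
  then show "\<exists>k e. fs = [k, e] \<and> short_exact A k e \<and> Dom A k = Y \<and> Cod A e = X"
    using * unfolding yoneda_extensions_def short_exact_def by auto
qed (auto simp: yoneda_extensions_def short_exact_def)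

lemma yoneda_morphism_1:
  assumes "([k, e], [k', e']) \<in> yoneda_morphism A 1 X Y"
  shows "\<exists>h \<in> homs A (Cod A k) (Cod A k'). h \<cdot> k = k' \<and> e' \<cdot> h = e"
proof -
  have ses: "short_exact A k e" "Dom A k = Y" "Cod A e = X" "short_exact A k' e'" "Dom A k' = Y" "Cod A e' = X"
    using assms unfolding yoneda_morphism_def yoneda_extensions_1 by auto
  then have hm: "k' \<in> homs A Y (Cod A k')" "e \<in> homs A (Cod A k) X" "e' \<in> homs A (Cod A k') X"
    using short_exact_homs by metis+
  obtain h :: "nat \<Rightarrow> 'b" where h: "h 0 = Ident A Y" "h (Suc 1) = Ident A X"
    "\<forall>i\<le>1. h i \<in> homs A (Dom A ([k, e] ! i)) (Dom A ([k', e'] ! i)) \<and> h (Suc i) \<cdot> ([k, e] ! i) = ([k', e'] ! i) \<cdot> h i"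
    using assms unfolding yoneda_morphism_def by blast
  have "h 1 \<in> homs A (Dom A e) (Dom A e')" "h 1 \<cdot> k = k' \<cdot> Ident A Y" "Ident A X \<cdot> e = e' \<cdot> h 1"
    using h(3)[rule_format, of 0] h(3)[rule_format, of 1] h(1,2) by (simp_all add: numeral_2_eq_2)
  moreover have "Dom A e = Cod A k" "Dom A e' = Cod A k'" using hm homs_eqs by metis+
  ultimately show ?thesis using Ident_left[OF hm(2)] Ident_right[OF hm(1)] by metis
qed

lemma yoneda_morphism_1I:
  assumes "short_exact A k e" "short_exact A k' e'" "k \<in> homs A Y E" "e \<in> homs A E X" "k' \<in> homs A Y E'" "e' \<in> homs A E' X"
    and "h \<in> homs A E E'" "h \<cdot> k = k'" "e' \<cdot> h = e"
  shows "([k, e], [k', e']) \<in> yoneda_morphism A 1 X Y"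
proof -
  \<comment> \<open>Of the three components only the middle one carries information; positions 0 and
    2 must be the identities on \<open>Y\<close> and \<open>X\<close>, the latter being supplied by
    the default branch.\<close>
  define g where "g i = (if i = 0 then Ident A Y else if i = Suc 0 then h else Ident A X)" for i :: nat
  have y: "[k, e] \<in> yoneda_extensions A 1 X Y" "[k', e'] \<in> yoneda_extensions A 1 X Y"
    unfolding yoneda_extensions_1 using assms homs_eqs by auto
  have "g i \<in> homs A (Dom A ([k, e] ! i)) (Dom A ([k', e'] ! i)) \<and> g (Suc i) \<cdot> ([k, e] ! i) = ([k', e'] ! i) \<cdot> g i"
    if i: "i \<le> 1" for i
  proof (cases i)
    case 0
    then show ?thesis
      using homs_eqs[OF assms(3)] homs_eqs[OF assms(5)] Ident_closed homs_Obj[OF assms(3)] assms(8)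
        Ident_right[OF assms(5)] by (simp add: g_def)
  next
    case (Suc n)
    then show ?thesis using i
      using homs_eqs[OF assms(4)] homs_eqs[OF assms(6)] assms(7,9) Ident_left[OF assms(4)]
      by (simp add: g_def)
  qed
  moreover have "g 0 = Ident A Y" "g (Suc 1) = Ident A X" by (simp_all add: g_def)
  ultimately show ?thesis unfolding yoneda_morphism_def using y by blast
qed

text \<open>The biproduct extension serves as base point. Being split is invariant under morphisms
  of extensions in both directions, hence along zigzags, and every split extension maps to the
  biproduct. So the class of the base point consists exactly of the split extensions.\<close>

lemma Ext_zero_iff_split:
  assumes "X \<in> Obj A" "Y \<in> Obj A"
  shows "Ext_zero A 1 X Y \<longleftrightarrow> (\<forall>k e. short_exact A k e \<and> Dom A k = Y \<and> Cod A e = X \<longrightarrow>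
    (\<exists>r \<in> homs A (Cod A k) Y. r \<cdot> k = Ident A Y))"
proof -
  obtain S i1 i2 p1 p2 where S: "is_biproduct A Y X S i1 i2 p1 p2"
    using direct_sums assms unfolding is_direct_sum_def by blast
  then have h: "i1 \<in> homs A Y S" "i2 \<in> homs A X S" "p1 \<in> homs A S Y" "p2 \<in> homs A S X"
    and e: "p1 \<cdot> i1 = Ident A Y" "p2 \<cdot> i2 = Ident A X" "p1 \<cdot> i2 = ZeroArr A X Y" "p2 \<cdot> i1 = ZeroArr A Y X"
    by (auto simp: is_biproduct_def)
  let ?Y = "yoneda_extensions A 1 X Y" and ?M = "yoneda_morphism A 1 X Y"
  let ?R = "(?M \<union> ?M\<inverse>)\<^sup>*"
  note sS = biproduct_short_exact[OF S]
  have sY: "[i1, p2] \<in> ?Y" using sS h homs_eqs unfolding yoneda_extensions_1 by blast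
  have sym: "sym ?R" by (intro sym_rtrancl) (auto simp: sym_def)
  define split where "split fs \<longleftrightarrow> (\<exists>r \<in> homs A (Cod A (hd fs)) Y. r \<cdot> hd fs = Ident A Y)" for fs
  have step: "split fs \<longleftrightarrow> split gs" if M: "(fs, gs) \<in> ?M" for fs gs
  proof -
    have "fs \<in> ?Y" "gs \<in> ?Y" using M by (auto simp: yoneda_morphism_def)
    then obtain k e k' e' where ke: "fs = [k, e]" "short_exact A k e" "Dom A k = Y" "Cod A e = X"
      "gs = [k', e']" "short_exact A k' e'" "Dom A k' = Y" "Cod A e' = X" unfolding yoneda_extensions_1 by blast
    have kh: "k \<in> homs A Y (Cod A k)" "e \<in> homs A (Cod A k) X" "k' \<in> homs A Y (Cod A k')" "e' \<in> homs A (Cod A k') X"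
      using short_exact_homs ke by metis+
    obtain t where t: "t \<in> homs A (Cod A k) (Cod A k')" "t \<cdot> k = k'" "e' \<cdot> t = e"
      using yoneda_morphism_1 M ke by blast
    show ?thesis
    proof
      assume "split fs"
      then obtain r where "r \<in> homs A (Cod A k) Y" "r \<cdot> k = Ident A Y" by (auto simp: split_def ke)
      \<comment> \<open>A retraction of \<open>k\<close> cannot be carried forward along
        \<open>t\<close>, but a section of \<open>e\<close> can; so the splitting is converted to a
        section, composed with \<open>t\<close>, and converted back. Backwards, a retraction of
        \<open>k'\<close> simply composes with \<open>t\<close>.\<close>
      then obtain s where s: "s \<in> homs A X (Cod A k)" "e \<cdot> s = Ident A X"
        using section_if_retraction[OF ke(2) kh(1,2)] by metis
      have "e' \<cdot> (t \<cdot> s) = Ident A X" using Comp_assoc[OF s(1) t(1) kh(4)] t s by metis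
      then show "split gs"
        using retraction_if_section[OF ke(6) kh(3,4) Comp_closed[OF s(1) t(1)]] by (auto simp: split_def ke)
    next
      assume "split gs"
      then obtain r where r: "r \<in> homs A (Cod A k') Y" "r \<cdot> k' = Ident A Y" by (auto simp: split_def ke)
      then have "r \<cdot> t \<cdot> k = Ident A Y" using Comp_assoc[OF kh(1) t(1) r(1)] t by metis
      then show "split fs" using Comp_closed[OF t(1) r(1)] by (auto simp: split_def ke)
    qed
  qed
  have inv: "split fs \<longleftrightarrow> split gs" if "(fs, gs) \<in> ?R" for fs gs
    using that by (induction rule: rtrancl_induct) (use step in blast)+
  have splitS: "split [i1, p2]" using h e homs_eqs by (auto simp: split_def)
  have RS: "(fs, [i1, p2]) \<in> ?R \<longleftrightarrow> split fs" if fsY: "fs \<in> ?Y" for fs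
  proof
    assume "(fs, [i1, p2]) \<in> ?R" then show "split fs" using inv splitS by blast
  next
    assume sp: "split fs"
    obtain k e where ke: "fs = [k, e]" "short_exact A k e" "Dom A k = Y" "Cod A e = X"
      using fsY unfolding yoneda_extensions_1 by blast
    let ?E = "Cod A k"
    have kh: "k \<in> homs A Y ?E" "e \<in> homs A ?E X" using short_exact_homs ke by metis+
    obtain r where r: "r \<in> homs A ?E Y" "r \<cdot> k = Ident A Y" using sp by (auto simp: split_def ke)
    have a: "i1 \<cdot> r \<in> homs A ?E S" "i2 \<cdot> e \<in> homs A ?E S" using Comp_closed h r kh by metis+
    \<comment> \<open>The arrow into the biproduct with components \<open>r\<close> and
      \<open>e\<close>.\<close>
    let ?h = "i1 \<cdot> r \<boxplus> i2 \<cdot> e"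
    have hh: "?h \<in> homs A ?E S" using Plus_closed a by metis
    have 1: "i1 \<cdot> r \<cdot> k = i1" using Comp_assoc[OF kh(1) r(1) h(1)] r Ident_right[OF h(1)] by metis
    have 2: "i2 \<cdot> e \<cdot> k = ZeroArr A Y S"
      using Comp_assoc[OF kh h(2)] short_exactD(3)[OF ke(2) kh] Comp_Zero_right[OF h(2) assms(2)] by metis
    have 3: "p2 \<cdot> (i1 \<cdot> r) = ZeroArr A ?E X"
      using Comp_assoc[OF r(1) h(1,4)] e(4) Comp_Zero_left[OF r(1) assms(1)] by metis
    have 4: "p2 \<cdot> (i2 \<cdot> e) = e" using Comp_assoc[OF kh(2) h(2,4)] e(2) Ident_left[OF kh(2)] by metis
    have "?h \<cdot> k = i1" using Comp_add_left[OF kh(1) a] 1 2 Plus_Zero[OF h(1)] by metis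
    moreover have "p2 \<cdot> ?h = e" using Comp_add_right[OF a h(4)] 3 4 Zero_Plus[OF kh(2)] by metis
    ultimately have "(fs, [i1, p2]) \<in> ?M" using yoneda_morphism_1I[OF ke(2) sS kh h(1,4) hh] ke(1) by metis
    then show "(fs, [i1, p2]) \<in> ?R" by blast
  qed
  have "Ext_zero A 1 X Y \<longleftrightarrow> (\<forall>fs \<in> ?Y. (fs, [i1, p2]) \<in> ?R)"
    unfolding Ext_zero_def yoneda_Ext_def
    by (rule is_singleton_quotient_iff[OF refl_rtrancl sym trans_rtrancl sY])
  also have "\<dots> \<longleftrightarrow> (\<forall>fs \<in> ?Y. split fs)" using RS by blast
  also have "\<dots> \<longleftrightarrow> (\<forall>k e. short_exact A k e \<and> Dom A k = Y \<and> Cod A e = X \<longrightarrow>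
    (\<exists>r \<in> homs A (Cod A k) Y. r \<cdot> k = Ident A Y))"
    unfolding split_def Ball_def yoneda_extensions_1 by (metis list.sel(1))
  finally show ?thesis .
qed

text \<open>Push out the given extension along \<open>f\<close>; a retraction of the resulting extension of \<open>G\<close>
  by \<open>M\<close> yields the extension of \<open>f\<close>.\<close>

lemma Ext_zero_extend:
  assumes ext: "Ext_zero A 1 G M" and ses: "short_exact A k e"
    and kh: "k \<in> homs A K P" and eh: "e \<in> homs A P G" and fh: "f \<in> homs A K M"
  shows "\<exists>t \<in> homs A P M. t \<cdot> k = f"
proof -
  have o: "G \<in> Obj A" "M \<in> Obj A" "K \<in> Obj A" "P \<in> Obj A" using homs_Obj assms by metis+
  note ke = short_exactD[OF ses kh eh]
  obtain S i1 i2 p1 p2 where S: "is_biproduct A M P S i1 i2 p1 p2"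
    using direct_sums o unfolding is_direct_sum_def by blast
  then have h: "i1 \<in> homs A M S" "i2 \<in> homs A P S" "p1 \<in> homs A S M" "p2 \<in> homs A S P" "S \<in> Obj A"
    and b: "p1 \<cdot> i1 = Ident A M" "p2 \<cdot> i2 = Ident A P" "p1 \<cdot> i2 = ZeroArr A P M" "p2 \<cdot> i1 = ZeroArr A M P"
      "i1 \<cdot> p1 \<boxplus> i2 \<cdot> p2 = Ident A S"
    by (auto simp: is_biproduct_def)
  have a: "i1 \<cdot> f \<in> homs A K S" "i2 \<cdot> k \<in> homs A K S" using Comp_closed h fh kh by metis+
  \<comment> \<open>The cokernel \<open>q\<close> of this difference is the pushout of
    \<open>f\<close> and \<open>k\<close>: it identifies \<open>i1 \<cdot> f\<close> with
    \<open>i2 \<cdot> k\<close>. The object \<open>E\<close> is the middle term of the new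
    extension, with \<open>j\<close> and \<open>g\<close> its two arrows.\<close>
  define u where "u = i1 \<cdot> f \<boxminus> i2 \<cdot> k"
  have uh: "u \<in> homs A K S" unfolding u_def using Minus_closed a by metis
  obtain q where q: "is_cokernel A q u" using cokernels homs_eqs[OF uh] by metis
  define E where "E = Cod A q"
  have qh: "q \<in> homs A S E" using is_cokernel_homs[OF q] homs_eqs[OF uh] E_def by metis
  have oE: "E \<in> Obj A" using homs_Obj qh by metis
  have qe: "epic A q" using q cokernel_epic by metis
  define j where "j = q \<cdot> i1"
  have jh: "j \<in> homs A M E" unfolding j_def using Comp_closed h qh by metis
  have p2f: "p2 \<cdot> (i1 \<cdot> f) = ZeroArr A K P"
    using Comp_assoc[OF fh h(1,4)] b(4) Comp_Zero_left[OF fh o(4)] by metis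
  have p2k: "p2 \<cdot> (i2 \<cdot> k) = k" using Comp_assoc[OF kh h(2,4)] b(2) Ident_left[OF kh] by metis
  have zKP: "ZeroArr A K P \<in> homs A K P" using ZeroArr_closed o by metis
  \<comment> \<open>The second component of \<open>u\<close> is the negative of \<open>k\<close>,
    spelled as a difference with zero. Its being monic makes \<open>u\<close> monic and, through
    \<open>u\<close>, also \<open>j\<close>.\<close>
  have p2u: "p2 \<cdot> u = ZeroArr A K P \<boxminus> k"
    unfolding u_def using Comp_Minus_right[OF a h(4)] p2f p2k by metis
  have ek: "e \<cdot> (ZeroArr A K P \<boxminus> k) = ZeroArr A K G"
    using Comp_Minus_right[OF zKP kh eh] ke(3) Comp_Zero_right[OF eh o(3)]
      Minus_eq_Zero_iff[of "ZeroArr A K G" K G] ZeroArr_closed[OF o(3,1)] by metis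
  have pe: "e \<cdot> p2 \<in> homs A S G" using Comp_closed h eh by metis
  have "e \<cdot> p2 \<cdot> u = ZeroArr A K G" using Comp_assoc[OF uh h(4) eh] p2u ek by metis
  then obtain g where g: "g \<in> homs A E G" "g \<cdot> q = e \<cdot> p2"
    using cokernel_factor[OF q uh qh pe] by metis
  have qu: "q \<cdot> (i1 \<cdot> f) = q \<cdot> (i2 \<cdot> k)"
    using cokernel_zero[OF q uh qh] Comp_Minus_right[OF a qh] Minus_eq_Zero_iff[of "q \<cdot> (i1 \<cdot> f)" K E]
      Comp_closed a qh u_def by metis
  have mu: "monic A u"
  proof (rule monicI_Zero[OF uh])
    fix W y assume y: "y \<in> homs A W K" "u \<cdot> y = ZeroArr A W S"
    then have "(ZeroArr A K P \<boxminus> k) \<cdot> y = ZeroArr A W P"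
      using p2u Comp_assoc[OF y(1) uh h(4)] Comp_Zero_right[OF h(4)] homs_Obj[OF y(1)] by metis
    then have "ZeroArr A K P \<cdot> y = k \<cdot> y"
      using Comp_Minus_left[OF y(1) zKP kh] Minus_eq_Zero_iff[of "ZeroArr A K P \<cdot> y" W P] Comp_closed y zKP kh
      by metis
    then have "k \<cdot> y = ZeroArr A W P" using Comp_Zero_left[OF y(1) o(4)] by metis
    then show "y = ZeroArr A W K" using monic_Zero[OF ke(1) kh y(1)] by metis
  qed
  \<comment> \<open>Hence an arrow \<open>x\<close> killed by \<open>j\<close> has
    \<open>i1 \<cdot> x\<close> of the form \<open>u \<cdot> y\<close>; comparing second components
    gives that \<open>k\<close> kills \<open>y\<close>, so \<open>y\<close> and then
    \<open>x\<close> vanish.\<close>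
  note uk = kernel_of_cokernel[OF mu q]
  have mj: "monic A j"
  proof (rule monicI_Zero[OF jh])
    fix W x assume x: "x \<in> homs A W M" "j \<cdot> x = ZeroArr A W E"
    have W: "W \<in> Obj A" using homs_Obj x by metis
    have ix: "i1 \<cdot> x \<in> homs A W S" using Comp_closed x h by metis
    have "q \<cdot> (i1 \<cdot> x) = ZeroArr A W E" using Comp_assoc[OF x(1) h(1) qh] x j_def by metis
    then obtain y where y: "y \<in> homs A W K" "u \<cdot> y = i1 \<cdot> x" using kernel_factor[OF uk uh qh ix] by metis
    have "p2 \<cdot> (i1 \<cdot> x) = ZeroArr A W P"
      using Comp_assoc[OF x(1) h(1,4)] b(4) Comp_Zero_left[OF x(1) o(4)] by metis
    then have "(ZeroArr A K P \<boxminus> k) \<cdot> y = ZeroArr A W P" using y Comp_assoc[OF y(1) uh h(4)] p2u by metis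
    then have "ZeroArr A K P \<cdot> y = k \<cdot> y"
      using Comp_Minus_left[OF y(1) zKP kh] Minus_eq_Zero_iff[of "ZeroArr A K P \<cdot> y" W P] Comp_closed y zKP kh
      by metis
    then have "k \<cdot> y = ZeroArr A W P" using Comp_Zero_left[OF y(1) o(4)] by metis
    then have "y = ZeroArr A W K" using monic_Zero[OF ke(1) kh y(1)] by metis
    then have "i1 \<cdot> x = ZeroArr A W S" using y Comp_Zero_right[OF uh W] by metis
    then show "x = ZeroArr A W M" using monic_Zero[OF monic_if_retraction[OF h(1,3) b(1)] h(1) x(1)] by metis
  qed
  have "epic A (g \<cdot> q)" using g epic_comp[OF epic_if_section[OF h(4,2) b(2)] h(4) ke(2) eh] by simp
  then have eg: "epic A g"
    using epicI[OF g(1)] epic_cancel[of "g \<cdot> q", OF _ Comp_closed[OF qh g(1)]] Comp_assoc[OF qh g(1)] by metis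
  have gj: "g \<cdot> j = ZeroArr A M G"
    using Comp_assoc[OF h(1) qh g(1)] g(2) Comp_assoc[OF h(1,4) eh] b(4) Comp_Zero_right[OF eh o(2)] j_def
    by metis
  \<comment> \<open>If \<open>t\<close> kills \<open>j\<close>, the pushout identity makes
    \<open>t \<cdot> q \<cdot> i2\<close> kill \<open>k\<close>, so it descends along
    \<open>e\<close> to some \<open>s\<close>. Then \<open>t \<cdot> q\<close> and
    \<open>s \<cdot> g \<cdot> q\<close> agree on both summands of \<open>S\<close>, and
    \<open>q\<close> is cancelled.\<close>
  have "is_cokernel A g j"
  proof (rule is_cokernelI[OF jh g(1) eg gj])
    fix W t assume t: "t \<in> homs A E W" "t \<cdot> j = ZeroArr A M W"
    have W: "W \<in> Obj A" using homs_Obj t by metis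
    have tq: "t \<cdot> q \<in> homs A S W" and tqi: "t \<cdot> q \<cdot> i2 \<in> homs A P W" using Comp_closed t qh h by metis+
    have "t \<cdot> q \<cdot> i2 \<cdot> k = t \<cdot> (q \<cdot> (i2 \<cdot> k))"
      using Comp_assoc[OF kh h(2) tq] Comp_assoc[OF a(2) qh t(1)] by metis
    also have "\<dots> = t \<cdot> (j \<cdot> f)" using qu Comp_assoc[OF fh h(1) qh] j_def by metis
    also have "\<dots> = ZeroArr A K W" using Comp_assoc[OF fh jh t(1)] t(2) Comp_Zero_left[OF fh W] by metis
    finally obtain s where s: "s \<in> homs A G W" "s \<cdot> e = t \<cdot> q \<cdot> i2"
      using cokernel_factor[OF ke(5) kh eh tqi] by metis
    have ip: "i1 \<cdot> p1 \<in> homs A S S" "i2 \<cdot> p2 \<in> homs A S S" using Comp_closed h by metis+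
    have "t \<cdot> q \<cdot> i1 = ZeroArr A M W" using Comp_assoc[OF h(1) qh t(1)] t(2) j_def by metis
    then have 1: "t \<cdot> q \<cdot> (i1 \<cdot> p1) = ZeroArr A S W"
      using Comp_assoc[OF h(3,1) tq] Comp_Zero_left[OF h(3) W] by metis
    have 2: "t \<cdot> q \<cdot> (i2 \<cdot> p2) = s \<cdot> g \<cdot> q"
      using Comp_assoc[OF h(4,2) tq] s(2) Comp_assoc[OF h(4) eh s(1)] g(2) Comp_assoc[OF qh g(1) s(1)] by metis
    have "s \<cdot> g \<cdot> q \<in> homs A S W" using s g qh Comp_closed by metis
    then have "t \<cdot> q = s \<cdot> g \<cdot> q"
      using Comp_add_right[OF ip tq] b(5) Ident_right[OF tq] 1 2 Zero_Plus by metis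
    then have "s \<cdot> g = t" using epic_cancel[OF qe qh] t(1) Comp_closed[OF g(1) s(1)] by metis
    then show "\<exists>u\<in>homs A G W. u \<cdot> g = t" using s by auto
  qed
  then have "short_exact A j g" using short_exact_iff_cokernel mj by simp
  then obtain r where r: "r \<in> homs A E M" "r \<cdot> j = Ident A M"
    using ext Ext_zero_iff_split[OF o(1,2)] homs_eqs[OF jh] homs_eqs[OF g(1)] by metis
  have rq: "r \<cdot> q \<in> homs A S M" using Comp_closed r qh by metis
  \<comment> \<open>The desired extension is \<open>r\<close> restricted to the summand
    \<open>P\<close>: the pushout identity exchanges \<open>q \<cdot> i2 \<cdot> k\<close> for
    \<open>j \<cdot> f\<close>, and \<open>r\<close> undoes \<open>j\<close>.\<close>
  have "r \<cdot> q \<cdot> i2 \<cdot> k = r \<cdot> (q \<cdot> (i2 \<cdot> k))"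
    using Comp_assoc[OF kh h(2) rq] Comp_assoc[OF a(2) qh r(1)] by metis
  also have "\<dots> = r \<cdot> (j \<cdot> f)" using qu Comp_assoc[OF fh h(1) qh] j_def by metis
  also have "\<dots> = f" using Comp_assoc[OF fh jh r(1)] r(2) Ident_left[OF fh] by metis
  finally show ?thesis using Comp_closed[OF h(2) rq] by blast
qed

lemma projective_lift:
  assumes "Q \<in> projectives A" "epic A e" "e \<in> homs A X Y" "f \<in> homs A Q Y"
  shows "\<exists>t \<in> homs A Q X. e \<cdot> t = f"
  using assms homs_eqs[OF assms(3)] unfolding projectives_def by auto

text \<open>Given an extension \<open>j\<close>, \<open>g\<close> of \<open>G\<close> by
  \<open>M\<close>, projectivity lifts \<open>e\<close> through \<open>g\<close> to
  \<open>l\<close>. On \<open>K\<close> this lift lands in \<open>M\<close>, as an arrow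
  \<open>f\<close>. An extension \<open>t\<close> of \<open>f\<close> to \<open>P\<close> corrects
  \<open>l\<close> to an arrow that kills \<open>k\<close> and still lies over \<open>e\<close>, so
  it descends to a section of \<open>g\<close>.\<close>

lemma Ext_zeroI_projective:
  assumes ses: "short_exact A k e" and kh: "k \<in> homs A K P" and eh: "e \<in> homs A P G" and M: "M \<in> Obj A"
    and P: "P \<in> projectives A" and ext: "\<And>f. f \<in> homs A K M \<Longrightarrow> \<exists>t \<in> homs A P M. t \<cdot> k = f"
  shows "Ext_zero A 1 G M"
proof -
  have o: "G \<in> Obj A" "K \<in> Obj A" "P \<in> Obj A" using homs_Obj assms by metis+
  note ke = short_exactD[OF ses kh eh]
  have "\<exists>r \<in> homs A (Cod A j) M. r \<cdot> j = Ident A M"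
    if j: "short_exact A j g" "Dom A j = M" "Cod A g = G" for j g
  proof -
    define E where "E = Cod A j"
    have jh: "j \<in> homs A M E" and gh: "g \<in> homs A E G" using short_exact_homs j E_def by metis+
    have oE: "E \<in> Obj A" using homs_Obj jh by metis
    note jg = short_exactD[OF j(1) jh gh]
    obtain l where l: "l \<in> homs A P E" "g \<cdot> l = e" using projective_lift[OF P jg(2) gh eh] by metis
    have lk: "l \<cdot> k \<in> homs A K E" using Comp_closed kh l by metis
    have "g \<cdot> (l \<cdot> k) = ZeroArr A K G" using Comp_assoc[OF kh l(1) gh] l(2) ke(3) by metis
    then obtain f where f: "f \<in> homs A K M" "j \<cdot> f = l \<cdot> k" using kernel_factor[OF jg(4) jh gh lk] by metis
    obtain t where t: "t \<in> homs A P M" "t \<cdot> k = f" using ext f by metis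
    have jt: "j \<cdot> t \<in> homs A P E" using Comp_closed t jh by metis
    have d: "l \<boxminus> j \<cdot> t \<in> homs A P E" using Minus_closed l jt by metis
    have "j \<cdot> t \<cdot> k = l \<cdot> k" using Comp_assoc[OF kh t(1) jh] t f by metis
    then have "(l \<boxminus> j \<cdot> t) \<cdot> k = ZeroArr A K E"
      using Comp_Minus_left[OF kh l(1) jt] Minus_eq_Zero_iff[OF lk lk] by metis
    then obtain s where s: "s \<in> homs A G E" "s \<cdot> e = l \<boxminus> j \<cdot> t" using cokernel_factor[OF ke(5) kh eh d] by metis
    have "g \<cdot> (j \<cdot> t) = ZeroArr A P G"
      using Comp_assoc[OF t(1) jh gh] jg(3) Comp_Zero_left[OF t(1) o(1)] by metis
    then have "g \<cdot> (l \<boxminus> j \<cdot> t) = e" using Comp_Minus_right[OF l(1) jt gh] l(2) Minus_Zero[OF eh] by metis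
    then have "g \<cdot> s \<cdot> e = Ident A G \<cdot> e" using s Comp_assoc[OF eh s(1) gh] Ident_left[OF eh] by metis
    then have "g \<cdot> s = Ident A G"
      using epic_cancel[OF ke(2) eh] Comp_closed[OF s(1) gh] Ident_closed[OF o(1)] by metis
    then show ?thesis using retraction_if_section[OF j(1) jh gh s(1)] E_def by metis
  qed
  then show ?thesis using Ext_zero_iff_split[OF o(1) M] by blast
qed

end

section \<open>Classes with projective syzygies and cosyzygies\<close>

text \<open>Isolates what the closure arguments take from Gorenstein objects. The extension clause
  in \<open>syzygy\<close> amounts to Ext^1(X, Q) = 0 for projective \<open>Q\<close>, written in
  the form in which the exactness under Hom(-, C) delivers it.\<close>

locale syzygy_class = abelian_category A
  for A :: "('o, 'm, 'z) precat_scheme" (structure) +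
  fixes \<G> :: "'o set"
  assumes syzygy: "X \<in> \<G> \<Longrightarrow> \<exists>k e K P. short_exact A k e \<and> k \<in> homs A K P \<and> e \<in> homs A P X \<and>
      K \<in> \<G> \<and> P \<in> projectives A \<and> (\<forall>Q\<in>projectives A. \<forall>f\<in>homs A K Q. \<exists>t\<in>homs A P Q. t \<cdot> k = f)"
    and cosyzygy: "X \<in> \<G> \<Longrightarrow> \<exists>k e P Z. short_exact A k e \<and> k \<in> homs A X P \<and> e \<in> homs A P Z \<and>
      P \<in> projectives A \<and> Z \<in> \<G>"
begin

section \<open>Orthogonality to the class as an extension property\<close>

lemma perp_Obj: "M \<in> right_perp1 A \<G> \<Longrightarrow> M \<in> Obj A"
  by (simp add: right_perp1_def)

lemma perp_extend:
  assumes "M \<in> right_perp1 A \<G>" "X \<in> \<G>" "short_exact A k e" "k \<in> homs A K P" "e \<in> homs A P X"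
    and "f \<in> homs A K M"
  shows "\<exists>t \<in> homs A P M. t \<cdot> k = f"
  using Ext_zero_extend[of X M k e K P f] assms by (auto simp: right_perp1_def)

text \<open>Membership need only be tested against the presentation provided by
  \<open>syzygy\<close> for each \<open>X\<close>, whereas \<open>perp_extend\<close> applies to
  every short exact sequence ending in \<open>X\<close>. The premises list all properties of that
  presentation, so that each closure proof can draw on those that it requires.\<close>

lemma perpI:
  assumes "M \<in> Obj A"
    and "\<And>X k e K P f. X \<in> \<G> \<Longrightarrow> short_exact A k e \<Longrightarrow> k \<in> homs A K P \<Longrightarrow> e \<in> homs A P X \<Longrightarrow>
      K \<in> \<G> \<Longrightarrow> P \<in> projectives A \<Longrightarrow>
      (\<forall>Q\<in>projectives A. \<forall>f\<in>homs A K Q. \<exists>t\<in>homs A P Q. t \<cdot> k = f) \<Longrightarrow>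
      f \<in> homs A K M \<Longrightarrow> \<exists>t \<in> homs A P M. t \<cdot> k = f"
  shows "M \<in> right_perp1 A \<G>"
proof -
  have "Ext_zero A 1 X M" if X: "X \<in> \<G>" for X
  proof -
    obtain k e K P where *: "short_exact A k e" "k \<in> homs A K P" "e \<in> homs A P X" "K \<in> \<G>"
      "P \<in> projectives A" "\<forall>Q\<in>projectives A. \<forall>f\<in>homs A K Q. \<exists>t\<in>homs A P Q. t \<cdot> k = f"
      using syzygy[OF X] by blast
    show ?thesis using Ext_zeroI_projective[OF *(1-3) assms(1) *(5) assms(2)[OF X *]] .
  qed
  then show ?thesis using assms(1) by (simp add: right_perp1_def)
qed

text \<open>Extend \<open>i \<cdot> f\<close> and project back with \<open>p\<close>. Closure under
  isomorphisms and under direct summands are both instances.\<close>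

lemma perp_retract:
  assumes "M \<in> right_perp1 A \<G>" "i \<in> homs A N M" "p \<in> homs A M N" "p \<cdot> i = Ident A N"
  shows "N \<in> right_perp1 A \<G>"
proof (rule perpI)
  show "N \<in> Obj A" using homs_Obj assms by metis
  fix X k e K P f
  assume *: "X \<in> \<G>" "short_exact A k e" "k \<in> homs A K P" "e \<in> homs A P X" "f \<in> homs A K N"
  have "i \<cdot> f \<in> homs A K M" using Comp_closed * assms by metis
  then obtain t where t: "t \<in> homs A P M" "t \<cdot> k = i \<cdot> f" using perp_extend[OF assms(1) *(1-4)] by metis
  then have "p \<cdot> t \<cdot> k = f"
    using Comp_assoc[OF *(3) t(1) assms(3)] Comp_assoc[OF *(5) assms(2,3)] assms(4) Ident_left[OF *(5)] by metis
  then show "\<exists>t\<in>homs A P N. t \<cdot> k = f" using Comp_closed[OF t(1) assms(3)] by blast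
qed

lemma perp_zero_object:
  assumes "is_zero_object A Z"
  shows "Z \<in> right_perp1 A \<G>"
proof (rule perpI)
  show "Z \<in> Obj A" using assms by (simp add: is_zero_object_def)
  fix k K P f
  assume *: "k \<in> homs A K P" "f \<in> homs A K Z"
  then have o: "K \<in> Obj A" "P \<in> Obj A" using homs_Obj by metis+
  then obtain t where t: "t \<in> homs A P Z" using assms unfolding is_zero_object_def by blast
  then have "t \<cdot> k \<in> homs A K Z" using Comp_closed * by metis
  then have "t \<cdot> k = f" using assms o * unfolding is_zero_object_def by blast
  then show "\<exists>t\<in>homs A P Z. t \<cdot> k = f" using t by blast
qed

lemma perp_direct_sum:
  assumes "M \<in> right_perp1 A \<G>" "N \<in> right_perp1 A \<G>" "is_biproduct A M N S i1 i2 p1 p2"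
  shows "S \<in> right_perp1 A \<G>"
proof (rule perpI)
  have h: "i1 \<in> homs A M S" "i2 \<in> homs A N S" "p1 \<in> homs A S M" "p2 \<in> homs A S N"
    and b: "i1 \<cdot> p1 \<boxplus> i2 \<cdot> p2 = Ident A S"
    using assms(3) by (auto simp: is_biproduct_def)
  show "S \<in> Obj A" using homs_Obj h by metis
  fix X k e K P f
  assume *: "X \<in> \<G>" "short_exact A k e" "k \<in> homs A K P" "e \<in> homs A P X" "f \<in> homs A K S"
  obtain s where s: "s \<in> homs A P M" "s \<cdot> k = p1 \<cdot> f"
    using perp_extend[OF assms(1) *(1-4) Comp_closed[OF *(5) h(3)]] by metis
  obtain t where t: "t \<in> homs A P N" "t \<cdot> k = p2 \<cdot> f"
    using perp_extend[OF assms(2) *(1-4) Comp_closed[OF *(5) h(4)]] by metis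
  have a: "i1 \<cdot> s \<in> homs A P S" "i2 \<cdot> t \<in> homs A P S" and ip: "i1 \<cdot> p1 \<in> homs A S S" "i2 \<cdot> p2 \<in> homs A S S"
    using Comp_closed h s t by metis+
  have "i1 \<cdot> s \<cdot> k = i1 \<cdot> p1 \<cdot> f" using Comp_assoc[OF *(3) s(1) h(1)] Comp_assoc[OF *(5) h(3,1)] s by metis
  moreover have "i2 \<cdot> t \<cdot> k = i2 \<cdot> p2 \<cdot> f"
    using Comp_assoc[OF *(3) t(1) h(2)] Comp_assoc[OF *(5) h(4,2)] t by metis
  ultimately have "(i1 \<cdot> s \<boxplus> i2 \<cdot> t) \<cdot> k = f"
    using Comp_add_left[OF *(3) a] Comp_add_left[OF *(5) ip] b Ident_left[OF *(5)] by metis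
  then show "\<exists>t\<in>homs A P S. t \<cdot> k = f" using Plus_closed a by metis
qed

section \<open>Closure properties of the orthogonal class\<close>

lemma subcategory_perp: "subcategory A (right_perp1 A \<G>)"
  unfolding subcategory_def
proof (intro conjI allI impI ballI)
  show "right_perp1 A \<G> \<subseteq> Obj A" using perp_Obj by blast
  show "Y \<in> right_perp1 A \<G>" if "X \<in> right_perp1 A \<G> \<and> isomorphic A X Y" for X Y
    using that perp_retract unfolding isomorphic_def by blast
  show "\<exists>Z\<in>right_perp1 A \<G>. is_zero_object A Z" using zero_object perp_zero_object by blast
  show "T \<in> right_perp1 A \<G>"
    if "X \<in> right_perp1 A \<G>" "Y \<in> right_perp1 A \<G>" "is_direct_sum A X Y T" for X Y T
    using that perp_direct_sum unfolding is_direct_sum_def by blast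
qed

lemma closed_under_summands_perp: "closed_under_summands A (right_perp1 A \<G>)"
  unfolding closed_under_summands_def is_direct_sum_def is_biproduct_def
  using perp_retract by blast

text \<open>Extensions are chosen componentwise and assembled by the existence half of the universal
  property; its uniqueness half, applied to arrows from \<open>K\<close>, shows that the assembled
  arrow extends \<open>f\<close>.\<close>

lemma closed_under_products_perp: "closed_under_products TYPE('i) A (right_perp1 A \<G>)"
  unfolding closed_under_products_def
proof (intro allI impI)
  fix I :: "'i set" and M :: "'i \<Rightarrow> 'o" and L :: 'o and p :: "'i \<Rightarrow> 'm"
  assume "is_product A I M L p \<and> (\<forall>i\<in>I. M i \<in> right_perp1 A \<G>)"
  then have L: "L \<in> Obj A" and p: "\<And>i. i \<in> I \<Longrightarrow> p i \<in> homs A L (M i)"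
    and univ: "\<And>X f. X \<in> Obj A \<Longrightarrow> (\<And>i. i \<in> I \<Longrightarrow> f i \<in> homs A X (M i)) \<Longrightarrow>
      \<exists>!u. u \<in> homs A X L \<and> (\<forall>i\<in>I. p i \<cdot> u = f i)"
    and M: "\<And>i. i \<in> I \<Longrightarrow> M i \<in> right_perp1 A \<G>"
    unfolding is_product_def by auto
  show "L \<in> right_perp1 A \<G>"
  proof (rule perpI[OF L])
    fix X k e K P f
    assume *: "X \<in> \<G>" "short_exact A k e" "k \<in> homs A K P" "e \<in> homs A P X" "f \<in> homs A K L"
    have pf: "p i \<cdot> f \<in> homs A K (M i)" if "i \<in> I" for i using Comp_closed[OF *(5) p[OF that]] .
    have "\<exists>t \<in> homs A P (M i). t \<cdot> k = p i \<cdot> f" if "i \<in> I" for i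
      using perp_extend[OF M[OF that] *(1-4) pf[OF that]] .
    then obtain t where t: "\<And>i. i \<in> I \<Longrightarrow> t i \<in> homs A P (M i)" "\<And>i. i \<in> I \<Longrightarrow> t i \<cdot> k = p i \<cdot> f" by metis
    have o: "K \<in> Obj A" "P \<in> Obj A" using homs_Obj * by metis+
    obtain u where u: "u \<in> homs A P L" "\<And>i. i \<in> I \<Longrightarrow> p i \<cdot> u = t i" using univ[OF o(2) t(1)] by blast
    have uk: "u \<cdot> k \<in> homs A K L" using Comp_closed * u by metis
    have "p i \<cdot> (u \<cdot> k) = p i \<cdot> f" if "i \<in> I" for i
      using Comp_assoc[OF *(3) u(1) p[OF that]] u(2)[OF that] t(2)[OF that] by metis
    then have "u \<cdot> k = f" using univ[of K "\<lambda>i. p i \<cdot> f", OF o(1) pf] uk *(5) by blast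
    then show "\<exists>t\<in>homs A P L. t \<cdot> k = f" using u by blast
  qed
qed

text \<open>Extend \<open>b \<cdot> f\<close> to \<open>P\<close> and lift the result along
  \<open>b\<close>, using that \<open>P\<close> is projective. The error of this lift on
  \<open>K\<close> lies in \<open>L\<close>, where it can be extended and then added back.\<close>

lemma closed_under_extensions_perp: "closed_under_extensions A (right_perp1 A \<G>)"
  unfolding closed_under_extensions_def
proof (intro allI impI)
  fix a b assume ab: "short_exact A a b \<and> Dom A a \<in> right_perp1 A \<G> \<and> Cod A b \<in> right_perp1 A \<G>"
  define L M N where LMN: "L = Dom A a" "M = Cod A a" "N = Cod A b"
  have ah: "a \<in> homs A L M" and bh: "b \<in> homs A M N" and L: "L \<in> right_perp1 A \<G>" and N: "N \<in> right_perp1 A \<G>"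
    and ses: "short_exact A a b" using short_exact_homs ab LMN by metis+
  note sab = short_exactD[OF ses ah bh]
  have "M \<in> right_perp1 A \<G>"
  proof (rule perpI)
    show "M \<in> Obj A" using homs_Obj ah by metis
    fix X k e K P f
    assume *: "X \<in> \<G>" "short_exact A k e" "k \<in> homs A K P" "e \<in> homs A P X" "f \<in> homs A K M"
      and P: "P \<in> projectives A"
    obtain t where t: "t \<in> homs A P N" "t \<cdot> k = b \<cdot> f"
      using perp_extend[OF N *(1-4) Comp_closed[OF *(5) bh]] by metis
    obtain t' where t': "t' \<in> homs A P M" "b \<cdot> t' = t" using projective_lift[OF P sab(2) bh t(1)] by metis
    have tk: "t' \<cdot> k \<in> homs A K M" using Comp_closed t' * by metis
    have "b \<cdot> (f \<boxminus> t' \<cdot> k) = ZeroArr A K N"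
      using Comp_Minus_right[OF *(5) tk bh] Comp_assoc[OF *(3) t'(1) bh] t t' Minus_eq_Zero_iff
        Comp_closed[OF *(5) bh] by metis
    then obtain g where g: "g \<in> homs A K L" "a \<cdot> g = f \<boxminus> t' \<cdot> k"
      using kernel_factor[OF sab(4) ah bh Minus_closed[OF *(5) tk]] by metis
    obtain s where s: "s \<in> homs A P L" "s \<cdot> k = g" using perp_extend[OF L *(1-4) g(1)] by metis
    have as: "a \<cdot> s \<in> homs A P M" using Comp_closed ah s by metis
    have "(a \<cdot> s \<boxplus> t') \<cdot> k = f"
      using Comp_add_left[OF *(3) as t'(1)] Comp_assoc[OF *(3) s(1) ah] s(2) g(2) Minus_Plus[OF *(5) tk] by metis
    then show "\<exists>t\<in>homs A P M. t \<cdot> k = f" using Plus_closed as t' by metis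
  qed
  then show "Cod A a \<in> right_perp1 A \<G>" using LMN by simp
qed

text \<open>The extension clause of \<open>syzygy\<close> is literally the condition that
  \<open>perpI\<close> demands.\<close>

lemma projectives_perp: "projectives A \<subseteq> right_perp1 A \<G>"
proof
  fix Q assume Q: "Q \<in> projectives A"
  show "Q \<in> right_perp1 A \<G>" by (rule perpI) (use Q in \<open>auto simp: projectives_def\<close>)
qed

lemma injectives_perp: "injectives A \<subseteq> right_perp1 A \<G>"
proof
  fix J assume J: "J \<in> injectives A"
  show "J \<in> right_perp1 A \<G>"
  proof (rule perpI)
    show "J \<in> Obj A" using J by (simp add: injectives_def)
    fix k :: 'm and e K P f
    assume *: "short_exact A k e" "k \<in> homs A K P" "f \<in> homs A K J"
    have "monic A k" using * by (simp add: short_exact_def)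
    then show "\<exists>t\<in>homs A P J. t \<cdot> k = f" using J * homs_eqs[OF *(2)] by (auto simp: injectives_def)
  qed
qed

text \<open>For \<open>0 \<rightarrow> L \<rightarrow> M \<rightarrow> N \<rightarrow> 0\<close>, every arrow from \<open>X\<close> to \<open>N\<close> lifts to \<open>M\<close>: it extends to
  a projective containing \<open>X\<close>, where it lifts. So the connecting map to \<open>Ext\<^sup>1(X, L)\<close> vanishes.\<close>

lemma closed_under_kernels_of_epis_perp: "closed_under_kernels_of_epis A (right_perp1 A \<G>)"
  unfolding closed_under_kernels_of_epis_def
proof (intro allI impI)
  fix a b
  assume ab: "epic A b \<and> is_kernel A a b \<and> Dom A b \<in> right_perp1 A \<G> \<and> Cod A b \<in> right_perp1 A \<G>"
  define L M N where LMN: "L = Dom A a" "M = Dom A b" "N = Cod A b"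
  have ah: "a \<in> homs A L M" and bh: "b \<in> homs A M N" and M: "M \<in> right_perp1 A \<G>" and N: "N \<in> right_perp1 A \<G>"
    and sab: "epic A b" "is_kernel A a b" "monic A a" using is_kernel_homs kernel_monic ab LMN by metis+
  have "L \<in> right_perp1 A \<G>"
  proof (rule perpI)
    show "L \<in> Obj A" using homs_Obj ah by metis
    fix X k e K P f
    assume *: "X \<in> \<G>" "short_exact A k e" "k \<in> homs A K P" "e \<in> homs A P X" "f \<in> homs A K L"
    note ke = short_exactD[OF *(2-4)]
    have af: "a \<cdot> f \<in> homs A K M" using Comp_closed * ah by metis
    obtain t where t: "t \<in> homs A P M" "t \<cdot> k = a \<cdot> f" using perp_extend[OF M *(1-4) af] by metis
    have bt: "b \<cdot> t \<in> homs A P N" using Comp_closed t bh by metis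
    have "b \<cdot> t \<cdot> k = ZeroArr A K N"
      using Comp_assoc[OF *(3) t(1) bh] t(2) Comp_assoc[OF *(5) ah bh] kernel_zero[OF sab(2) ah bh]
        Comp_Zero_left[OF *(5)] homs_Obj[OF bh] by metis
    \<comment> \<open>The arrow \<open>g\<close> is the obstruction to \<open>t\<close> landing in
      \<open>L\<close>. Once it is lifted to \<open>h\<close> from \<open>X\<close> to
      \<open>M\<close>, subtracting \<open>h \<cdot> e\<close> removes the obstruction, and leaves
      \<open>t \<cdot> k\<close> unchanged because \<open>e\<close> kills \<open>k\<close>.\<close>
    then obtain g where g: "g \<in> homs A X N" "g \<cdot> e = b \<cdot> t" using cokernel_factor[OF ke(5) *(3,4) bt] by metis
    obtain k' e' P' Z where c: "Z \<in> \<G>" "short_exact A k' e'" "k' \<in> homs A X P'" "e' \<in> homs A P' Z" "P' \<in> projectives A"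
      using cosyzygy[OF *(1)] by blast
    obtain g' where g': "g' \<in> homs A P' N" "g' \<cdot> k' = g" using perp_extend[OF N c(1-4) g(1)] by metis
    obtain l where l: "l \<in> homs A P' M" "b \<cdot> l = g'" using projective_lift[OF c(5) sab(1) bh g'(1)] by metis
    define h where "h = l \<cdot> k'"
    have h: "h \<in> homs A X M" "b \<cdot> h = g"
      unfolding h_def using Comp_closed[OF c(3) l(1)] Comp_assoc[OF c(3) l(1) bh] l(2) g' by metis+
    have he: "h \<cdot> e \<in> homs A P M" using Comp_closed h * by metis
    have "b \<cdot> (h \<cdot> e) = b \<cdot> t" using Comp_assoc[OF *(4) h(1) bh] h(2) g(2) by metis
    then have "b \<cdot> (t \<boxminus> h \<cdot> e) = ZeroArr A P N"
      using Comp_Minus_right[OF t(1) he bh] Minus_eq_Zero_iff[OF bt bt] by metis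
    then obtain s where s: "s \<in> homs A P L" "a \<cdot> s = t \<boxminus> h \<cdot> e"
      using kernel_factor[OF sab(2) ah bh Minus_closed[OF t(1) he]] by metis
    have "h \<cdot> e \<cdot> k = ZeroArr A K M"
      using Comp_assoc[OF *(3,4) h(1)] ke(3) Comp_Zero_right[OF h(1)] homs_Obj[OF *(3)] by metis
    then have "(t \<boxminus> h \<cdot> e) \<cdot> k = a \<cdot> f"
      using Comp_Minus_left[OF *(3) t(1) he] t(2) Minus_Zero[OF af] by metis
    then have "a \<cdot> (s \<cdot> k) = a \<cdot> f" using s(2) Comp_assoc[OF *(3) s(1) ah] by metis
    then have "s \<cdot> k = f" using monic_cancel[OF sab(3) ah] Comp_closed[OF *(3) s(1)] *(5) by metis
    then show "\<exists>t\<in>homs A P L. t \<cdot> k = f" using s by blast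
  qed
  then show "Dom A a \<in> right_perp1 A \<G>" using LMN by simp
qed

text \<open>The piece of the long exact sequence by which Ext^1(X, L) = 0 makes Hom(X, M) map onto
  Hom(X, N). It is obtained from a projective presentation of \<open>X\<close>: lift
  \<open>f \<cdot> e\<close> to \<open>t\<close>; its restriction to \<open>K\<close> lands in
  \<open>L\<close> and extends to \<open>P\<close>; after subtraction \<open>t\<close> kills
  \<open>k\<close> and descends to \<open>X\<close>.\<close>

lemma perp_lift:
  assumes "X \<in> \<G>" "short_exact A a b" "a \<in> homs A L M" "b \<in> homs A M N" "L \<in> right_perp1 A \<G>" "f \<in> homs A X N"
  shows "\<exists>g \<in> homs A X M. b \<cdot> g = f"
proof -
  note sab = short_exactD[OF assms(2-4)]
  obtain k e K P where *: "short_exact A k e" "k \<in> homs A K P" "e \<in> homs A P X" "P \<in> projectives A"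
    using syzygy[OF assms(1)] by blast
  note ke = short_exactD[OF *(1-3)]
  obtain t where t: "t \<in> homs A P M" "b \<cdot> t = f \<cdot> e"
    using projective_lift[OF *(4) sab(2) assms(4) Comp_closed[OF *(3) assms(6)]] by metis
  have tk: "t \<cdot> k \<in> homs A K M" using Comp_closed t * by metis
  have "b \<cdot> (t \<cdot> k) = ZeroArr A K N"
    using Comp_assoc[OF *(2) t(1) assms(4)] t(2) Comp_assoc[OF *(2,3) assms(6)] ke(3)
      Comp_Zero_right[OF assms(6)] homs_Obj[OF *(2)] by metis
  then obtain r where r: "r \<in> homs A K L" "a \<cdot> r = t \<cdot> k" using kernel_factor[OF sab(4) assms(3,4) tk] by metis
  obtain s where s: "s \<in> homs A P L" "s \<cdot> k = r" using perp_extend[OF assms(5,1) *(1-3) r(1)] by metis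
  have as: "a \<cdot> s \<in> homs A P M" using Comp_closed s assms by metis
  have d: "t \<boxminus> a \<cdot> s \<in> homs A P M" using Minus_closed[OF t(1) as] .
  have "(t \<boxminus> a \<cdot> s) \<cdot> k = ZeroArr A K M"
    using Comp_Minus_left[OF *(2) t(1) as] Comp_assoc[OF *(2) s(1) assms(3)] s(2) r(2) Minus_eq_Zero_iff[OF tk tk]
    by metis
  then obtain g where g: "g \<in> homs A X M" "g \<cdot> e = t \<boxminus> a \<cdot> s" using cokernel_factor[OF ke(5) *(2,3) d] by metis
  have fe: "f \<cdot> e \<in> homs A P N" using Comp_closed * assms by metis
  have "b \<cdot> (a \<cdot> s) = ZeroArr A P N"
    using Comp_assoc[OF s(1) assms(3,4)] sab(3) Comp_Zero_left[OF s(1)] homs_Obj[OF assms(4)] by metis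
  then have "b \<cdot> (t \<boxminus> a \<cdot> s) = f \<cdot> e" using Comp_Minus_right[OF t(1) as assms(4)] t(2) Minus_Zero[OF fe] by metis
  then have "b \<cdot> g \<cdot> e = f \<cdot> e" using Comp_assoc[OF *(3) g(1) assms(4)] g(2) by metis
  then have "b \<cdot> g = f" using epic_cancel[OF ke(2) *(3)] Comp_closed[OF g(1) assms(4)] assms(6) by metis
  then show ?thesis using g by blast
qed

text \<open>An arrow from \<open>K\<close> to \<open>N\<close> first lifts to \<open>M\<close>,
  because \<open>K\<close> itself belongs to the class and \<open>L\<close> is orthogonal to it; the
  lift then extends to \<open>P\<close>, because \<open>M\<close> is orthogonal to
  \<open>X\<close>.\<close>

lemma closed_under_cokernels_of_monos_perp: "closed_under_cokernels_of_monos A (right_perp1 A \<G>)"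
  unfolding closed_under_cokernels_of_monos_def
proof (intro allI impI)
  fix a b
  assume ab: "monic A a \<and> is_cokernel A b a \<and> Dom A a \<in> right_perp1 A \<G> \<and> Cod A a \<in> right_perp1 A \<G>"
  define L M N where LMN: "L = Dom A a" "M = Cod A a" "N = Cod A b"
  have ah: "a \<in> homs A L M" and bh: "b \<in> homs A M N" and L: "L \<in> right_perp1 A \<G>" and M: "M \<in> right_perp1 A \<G>"
    and ses: "short_exact A a b" using is_cokernel_homs short_exact_iff_cokernel ab LMN by metis+
  have "N \<in> right_perp1 A \<G>"
  proof (rule perpI)
    show "N \<in> Obj A" using homs_Obj bh by metis
    fix X k e K P f
    assume *: "X \<in> \<G>" "short_exact A k e" "k \<in> homs A K P" "e \<in> homs A P X" "f \<in> homs A K N" and K: "K \<in> \<G>"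
    obtain g where g: "g \<in> homs A K M" "b \<cdot> g = f" using perp_lift[OF K ses ah bh L *(5)] by metis
    obtain t where t: "t \<in> homs A P M" "t \<cdot> k = g" using perp_extend[OF M *(1-4) g(1)] by metis
    then have "b \<cdot> t \<cdot> k = f" using Comp_assoc[OF *(3) t(1) bh] g by metis
    then show "\<exists>t\<in>homs A P N. t \<cdot> k = f" using Comp_closed[OF t(1) bh] by blast
  qed
  then show "Cod A b \<in> right_perp1 A \<G>" using LMN by simp
qed

end

section \<open>The Gorenstein subcategory\<close>

context abelian_category
begin

lemma orthogonal_generated_eq_projectives:
  assumes "Ext_orthogonal A C C" "generator_for A (projectives A) C" "C \<subseteq> Obj A"
  shows "C = projectives A"
proof
  show "projectives A \<subseteq> C" using assms by (simp add: generator_for_def)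
  show "C \<subseteq> projectives A"
  proof
    fix Y assume Y: "Y \<in> C"
    then obtain k e where ke: "short_exact A k e" "Dom A k \<in> C" "Cod A k \<in> projectives A" "Cod A e = Y"
      using assms(2) by (auto simp: generator_for_def)
    define P where "P = Cod A k"
    have kh: "k \<in> homs A (Dom A k) P" and eh: "e \<in> homs A P Y" using short_exact_homs ke P_def by metis+
    have "Ext_zero A 1 Y (Dom A k)" using assms(1) Y ke(2) by (simp add: Ext_orthogonal_def)
    then obtain r where r: "r \<in> homs A P (Dom A k)" "r \<cdot> k = Ident A (Dom A k)"
      using Ext_zero_iff_split[of Y "Dom A k"] Y ke assms(3) P_def by blast
    then obtain s where s: "s \<in> homs A Y P" "e \<cdot> s = Ident A Y"
      using section_if_retraction[OF ke(1) kh eh] by metis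
    \<comment> \<open>\<open>Y\<close> is now a retract of the projective \<open>P\<close>: lift
      \<open>f \<cdot> e\<close> from \<open>P\<close> and restrict along the section
      \<open>s\<close>.\<close>
    have "\<exists>g\<in>homs A Y (Dom A q). q \<cdot> g = f" if q: "epic A q" "f \<in> homs A Y (Cod A q)" for q f
    proof -
      have qh: "q \<in> homs A (Dom A q) (Cod A q)" using q by (auto simp: epic_def homs_def)
      obtain t where t: "t \<in> homs A P (Dom A q)" "q \<cdot> t = f \<cdot> e"
        using projective_lift[of P q, OF _ q(1) qh Comp_closed[OF eh q(2)]] ke(3) P_def by metis
      have "q \<cdot> (t \<cdot> s) = f"
        using Comp_assoc[OF s(1) t(1) qh] t(2) Comp_assoc[OF s(1) eh q(2)] s(2) Ident_right[OF q(2)] by metis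
      then show ?thesis using Comp_closed[OF s(1) t(1)] by blast
    qed
    then show "Y \<in> projectives A" using Y assms(3) by (auto simp: projectives_def)
  qed
qed

text \<open>Exactness asserts the kernel property for one representative \<open>n\<close> of the
  image, possibly built from another cokernel than that of \<open>m\<close>. Comparing the cokernels
  gives a factorization of \<open>n\<close> through \<open>m\<close>, hence of everything that
  \<open>g\<close> kills. That \<open>g\<close> kills \<open>m\<close> is tested after the
  epimorphism \<open>d\<close>, where it becomes the vanishing of
  \<open>g \<cdot> f\<close>.\<close>

lemma image_is_kernel:
  assumes "exact_at A f g" "is_image A m f"
  shows "is_kernel A m g"
proof -
  obtain n where n: "is_image A n f" "is_kernel A n g" using assms by (auto simp: exact_at_def)
  obtain c c' where c: "is_cokernel A c f" "is_kernel A m c" "is_cokernel A c' f" "is_kernel A n c'"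
    using n assms by (auto simp: is_image_def)
  define X Y Z where XYZ: "X = Dom A f" "Y = Cod A f" "Z = Cod A g"
  define N M C C' where NM: "N = Dom A n" "M = Dom A m" "C = Cod A c" "C' = Cod A c'"
  have fh: "f \<in> homs A X Y" and gh: "g \<in> homs A Y Z"
    using assms(1) XYZ by (auto simp: exact_at_def homs_def)
  have ch: "c \<in> homs A Y C" "c' \<in> homs A Y C'" using is_cokernel_homs c NM XYZ by metis+
  have mh: "m \<in> homs A M Y" and nh: "n \<in> homs A N Y"
    using is_kernel_homs c NM homs_eqs[OF ch(1)] homs_eqs[OF ch(2)] by metis+
  obtain e where e: "e \<in> homs A X N" "n \<cdot> e = f" "epic A e" using image_factor[OF n(1) fh nh] by metis
  obtain d where d: "d \<in> homs A X M" "m \<cdot> d = f" "epic A d" "monic A m" using image_factor[OF assms(2) fh mh] by metis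
  obtain v where v: "v \<in> homs A C' C" "v \<cdot> c' = c"
    using cokernel_factor[OF c(3) fh ch(2,1) cokernel_zero[OF c(1) fh ch(1)]] by metis
  have "c \<cdot> n = ZeroArr A N C"
    using Comp_assoc[OF nh ch(2) v(1)] v(2) kernel_zero[OF c(4) nh ch(2)] Comp_Zero_right[OF v(1)] homs_Obj[OF nh]
    by metis
  then obtain w where w: "w \<in> homs A N M" "m \<cdot> w = n" using kernel_factor[OF c(2) mh ch(1) nh] by metis
  show ?thesis
  proof (rule is_kernelI[OF mh gh d(4)])
    have "g \<cdot> f = ZeroArr A X Z"
      using Comp_assoc[OF e(1) nh gh] e(2) kernel_zero[OF n(2) nh gh] Comp_Zero_left[OF e(1)] homs_Obj[OF gh] by metis
    then have "g \<cdot> m \<cdot> d = ZeroArr A X Z" using Comp_assoc[OF d(1) mh gh] d(2) by metis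
    then show "g \<cdot> m = ZeroArr A M Z" using epic_Zero[OF d(3,1) Comp_closed[OF mh gh]] by metis
    fix W x assume x: "x \<in> homs A W Y" "g \<cdot> x = ZeroArr A W Z"
    obtain u where u: "u \<in> homs A W N" "n \<cdot> u = x" using kernel_factor[OF n(2) nh gh x] by metis
    then have "m \<cdot> (w \<cdot> u) = x" using Comp_assoc[OF u(1) w(1) mh] w(2) by metis
    then show "\<exists>u\<in>homs A W M. m \<cdot> u = x" using Comp_closed[OF u(1) w(1)] by blast
  qed
qed

text \<open>Gorenstein objects are only isomorphic to an image in the sequence; this lemma and its
  counterpart on the right move the short exact sequences from the image to the object
  itself.\<close>

lemma short_exact_iso_left:
  assumes "short_exact A k e" "k \<in> homs A K P" "e \<in> homs A P X"
    and "i \<in> homs A K' K" "j \<in> homs A K K'" "i \<cdot> j = Ident A K" "j \<cdot> i = Ident A K'"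
  shows "short_exact A (k \<cdot> i) e"
proof -
  note ke = short_exactD[OF assms(1-3)]
  have kih: "k \<cdot> i \<in> homs A K' P" using Comp_closed assms by metis
  have "is_kernel A (k \<cdot> i) e"
  proof (rule is_kernelI[OF kih assms(3)])
    show "monic A (k \<cdot> i)" using monic_comp[OF ke(1) assms(2) monic_if_retraction[OF assms(4,5,7)] assms(4)] .
    show "e \<cdot> (k \<cdot> i) = ZeroArr A K' X"
      using Comp_assoc[OF assms(4,2,3)] ke(3) Comp_Zero_left[OF assms(4)] homs_Obj[OF assms(3)] by metis
    fix W x assume x: "x \<in> homs A W P" "e \<cdot> x = ZeroArr A W X"
    obtain u where u: "u \<in> homs A W K" "k \<cdot> u = x" using kernel_factor[OF ke(4) assms(2,3) x] by metis
    have ju: "j \<cdot> u \<in> homs A W K'" using Comp_closed u assms by metis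
    have "k \<cdot> i \<cdot> (j \<cdot> u) = x"
      using Comp_assoc[OF ju assms(4,2)] Comp_assoc[OF u(1) assms(5,4)] assms(6) Ident_left[OF u(1)] u(2) by metis
    then show "\<exists>u\<in>homs A W K'. k \<cdot> i \<cdot> u = x" using ju by blast
  qed
  then show ?thesis using ke(2) short_exact_iff_kernel by simp
qed

lemma short_exact_iso_right:
  assumes "short_exact A k e" "k \<in> homs A K P" "e \<in> homs A P X"
    and "i \<in> homs A X' X" "j \<in> homs A X X'" "i \<cdot> j = Ident A X" "j \<cdot> i = Ident A X'"
  shows "short_exact A k (j \<cdot> e)"
proof -
  note ke = short_exactD[OF assms(1-3)]
  have jeh: "j \<cdot> e \<in> homs A P X'" using Comp_closed assms by metis
  have "is_kernel A k (j \<cdot> e)"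
  proof (rule is_kernelI[OF assms(2) jeh ke(1)])
    show "j \<cdot> e \<cdot> k = ZeroArr A K X'"
      using Comp_assoc[OF assms(2,3,5)] ke(3) Comp_Zero_right[OF assms(5)] homs_Obj[OF assms(2)] by metis
    fix W x assume x: "x \<in> homs A W P" "j \<cdot> e \<cdot> x = ZeroArr A W X'"
    have ex: "e \<cdot> x \<in> homs A W X" using Comp_closed x assms by metis
    have "j \<cdot> (e \<cdot> x) = ZeroArr A W X'" using Comp_assoc[OF x(1) assms(3,5)] x(2) by metis
    then have "e \<cdot> x = ZeroArr A W X" using monic_Zero[OF monic_if_retraction[OF assms(5,4,6)] assms(5) ex] by metis
    then show "\<exists>u\<in>homs A W K. k \<cdot> u = x" using kernel_factor[OF ke(4) assms(2,3) x(1)] by metis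
  qed
  then show ?thesis
    using epic_comp[OF ke(2) assms(3) epic_if_section[OF assms(5,4,7)] assms(5)] short_exact_iff_kernel by simp
qed

text \<open>Shifting the sequence by \<open>n\<close> brings the image to position 0, so all images
  of the sequence are Gorenstein.\<close>

lemma Gorenstein_image:
  assumes "Gorenstein_sequence A C d" "is_image A m (d n)"
  shows "Dom A m \<in> Gorenstein A C"
proof -
  have "Gorenstein_sequence A C (\<lambda>k. d (n + k))"
    using assms(1) unfolding Gorenstein_sequence_def by (simp add: add.assoc[symmetric])
  moreover have "is_image A m (d (n + 0))" using assms(2) by simp
  moreover have o: "Dom A m \<in> Obj A" using assms(2) Dom_closed by (auto simp: is_image_def is_kernel_def)
  moreover have "isomorphic A (Dom A m) (Dom A m)"
    using o Ident_closed[OF o] Ident_left[OF Ident_closed[OF o]] unfolding isomorphic_def by blast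
  ultimately show ?thesis unfolding Gorenstein_def by blast
qed

text \<open>Cuts the long sequence into short ones: \<open>m\<close> is the kernel of the next
  differential, which is \<open>m' \<cdot> e\<close> with \<open>m'\<close> monic, so
  \<open>m\<close> is also the kernel of the epimorphism \<open>e\<close>.\<close>

lemma Gorenstein_short_exact:
  assumes "Gorenstein_sequence A C d" "is_image A m (d n)" "is_image A m' (d (n + 1))"
  shows "\<exists>e. short_exact A m e \<and> m \<in> homs A (Dom A m) (Dom A (d (n + 1))) \<and>
    e \<in> homs A (Dom A (d (n + 1))) (Dom A m') \<and> epic A e \<and> m' \<cdot> e = d (n + 1)"
proof -
  let ?f = "d (n + 1)"
  have ker: "is_kernel A m ?f" using image_is_kernel assms unfolding Gorenstein_sequence_def by blast
  then have mh: "m \<in> homs A (Dom A m) (Dom A ?f)" and fh: "?f \<in> homs A (Dom A ?f) (Cod A ?f)"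
    using is_kernel_homs by metis+
  have mh': "m' \<in> homs A (Dom A m') (Cod A ?f)"
    using assms(3) unfolding is_image_def is_kernel_def is_cokernel_def homs_def by auto
  obtain e where e: "e \<in> homs A (Dom A ?f) (Dom A m')" "m' \<cdot> e = ?f" "epic A e" "monic A m'"
    using image_factor[OF assms(3) fh mh'] by metis
  have "is_kernel A m (m' \<cdot> e)" using ker e(2) by simp
  then have "is_kernel A m e" using kernel_comp_monic mh mh' e by metis
  then show ?thesis using e mh short_exact_iff_kernel by blast
qed

lemma Gorenstein_cosyzygy:
  assumes "X \<in> Gorenstein A C"
  shows "\<exists>k e P Z. short_exact A k e \<and> k \<in> homs A X P \<and> e \<in> homs A P Z \<and> P \<in> C \<and> Z \<in> Gorenstein A C"
proof -
  obtain d m where d: "Gorenstein_sequence A C d" "is_image A m (d 0)" "isomorphic A X (Dom A m)"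
    using assms by (auto simp: Gorenstein_def)
  \<comment> \<open>Kept in the shape \<open>0 + 1\<close> to match
    \<open>Gorenstein_short_exact\<close> at \<open>n = 0\<close>.\<close>
  let ?P = "Dom A (d (0 + 1))"
  obtain i j where ij: "i \<in> homs A X (Dom A m)" "j \<in> homs A (Dom A m) X" "i \<cdot> j = Ident A (Dom A m)" "j \<cdot> i = Ident A X"
    using d(3) unfolding isomorphic_def by blast
  obtain m' where m': "is_image A m' (d (0 + 1))"
    using d(1) unfolding Gorenstein_sequence_def exact_at_def by blast
  obtain e where e: "short_exact A m e" "m \<in> homs A (Dom A m) ?P" "e \<in> homs A ?P (Dom A m')"
    using Gorenstein_short_exact[OF d(1,2) m'] by blast
  have "short_exact A (m \<cdot> i) e" using short_exact_iso_left[OF e ij] .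
  moreover have "m \<cdot> i \<in> homs A X ?P" using Comp_closed e ij by metis
  moreover have "?P \<in> C" using d(1) by (simp add: Gorenstein_sequence_def)
  ultimately show ?thesis using e(3) Gorenstein_image[OF d(1) m'] by blast
qed

text \<open>The syzygy is the image of \<open>d (- 1)\<close>, sitting inside
  \<open>Dom A (d 0)\<close>. For the extension clause, \<open>f\<close> is pulled back along the
  epimorphism \<open>e'\<close> from \<open>Dom A (d (- 1))\<close> onto \<open>K\<close>; the
  result kills \<open>d (- 2)\<close>, so exactness under Hom(-, Q) writes it as
  \<open>t \<cdot> d (- 1)\<close>, which is \<open>t \<cdot> k \<cdot> e'\<close>, and
  \<open>e'\<close> is cancelled.\<close>

lemma Gorenstein_syzygy:
  assumes "X \<in> Gorenstein A C"
  shows "\<exists>k e K P. short_exact A k e \<and> k \<in> homs A K P \<and> e \<in> homs A P X \<and> K \<in> Gorenstein A C \<and> P \<in> C \<and>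
    (\<forall>Q\<in>C. \<forall>f\<in>homs A K Q. \<exists>t\<in>homs A P Q. t \<cdot> k = f)"
proof -
  obtain d m where d: "Gorenstein_sequence A C d" "is_image A m (d 0)" "isomorphic A X (Dom A m)"
    using assms by (auto simp: Gorenstein_def)
  obtain i j where ij: "i \<in> homs A X (Dom A m)" "j \<in> homs A (Dom A m) X" "i \<cdot> j = Ident A (Dom A m)" "j \<cdot> i = Ident A X"
    using d(3) unfolding isomorphic_def by blast
  have "exact_at A (d (- 2)) (d (- 2 + 1))" "exact_at A (d (- 1)) (d (- 1 + 1))"
    using d(1) unfolding Gorenstein_sequence_def by blast+
  then have ex: "exact_at A (d (- 2)) (d (- 1))" "exact_at A (d (- 1)) (d 0)" by simp_all
  obtain k where k: "is_image A k (d (- 1))" using ex(2) unfolding exact_at_def by blast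
  obtain l where l: "is_image A l (d (- 2))" using ex(1) unfolding exact_at_def by blast
  define K P where KP: "K = Dom A k" "P = Dom A (d 0)"
  obtain e where e: "short_exact A k e" "k \<in> homs A K P" "e \<in> homs A P (Dom A m)"
    using Gorenstein_short_exact[OF d(1) k, of m] d(2) KP by auto
  obtain e' where e': "e' \<in> homs A (Dom A (d (- 1))) K" "epic A e'" "k \<cdot> e' = d (- 1)"
      and l': "short_exact A l e'" "l \<in> homs A (Dom A l) (Dom A (d (- 1)))"
    using Gorenstein_short_exact[OF d(1) l, of k] k KP by auto
  define Y1 Y2 where Y: "Y1 = Dom A (d (- 1))" "Y2 = Dom A (d (- 2))"
  have d2h: "d (- 2) \<in> homs A Y2 Y1" using ex(1) Y by (auto simp: exact_at_def homs_def)
  have d1h: "d (- 1) \<in> homs A Y1 P" using ex(2) Y KP by (auto simp: exact_at_def homs_def)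
  have eh': "e' \<in> homs A Y1 K" and lh: "l \<in> homs A (Dom A l) Y1" using e' l' Y by auto
  obtain e2 where e2: "e2 \<in> homs A Y2 (Dom A l)" "l \<cdot> e2 = d (- 2)" using image_factor[OF l d2h lh] by metis
  \<comment> \<open>The arrow \<open>d (- 2)\<close> factors through its image \<open>l\<close>,
    which is the kernel of \<open>e'\<close>.\<close>
  have ed: "e' \<cdot> d (- 2) = ZeroArr A Y2 K"
    using Comp_assoc[OF e2(1) lh eh'] e2 short_exactD(3)[OF l'(1) lh eh'] Comp_Zero_left[OF e2(1)] homs_Obj[OF eh']
    by metis
  have "\<exists>t\<in>homs A P Q. t \<cdot> k = f" if Q: "Q \<in> C" and f: "f \<in> homs A K Q" for Q f
  proof -
    have fe: "f \<cdot> e' \<in> homs A Y1 Q" using Comp_closed eh' f by metis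
    have "f \<cdot> e' \<cdot> d (- 2) = ZeroArr A Y2 Q"
      using Comp_assoc[OF d2h eh' f] ed Comp_Zero_right[OF f] homs_Obj[OF d2h] by metis
    then have fk: "f \<cdot> e' \<in> kernel (hom_group A Y1 Q) (hom_group A Y2 Q) (\<lambda>h. h \<cdot> d (- 2))"
      using fe by (simp add: kernel_def hom_group_def)
    have "Hom_into_exact_at A Q (d (- 2)) (d (- 2 + 1))"
      using d(1) Q unfolding Gorenstein_sequence_def by blast
    then have "(\<lambda>h. h \<cdot> d (- 1)) ` homs A P Q = kernel (hom_group A Y1 Q) (hom_group A Y2 Q) (\<lambda>h. h \<cdot> d (- 2))"
      unfolding Hom_into_exact_at_def using homs_eqs[OF d2h] homs_eqs[OF d1h] by simp
    then obtain t where t: "t \<in> homs A P Q" "t \<cdot> d (- 1) = f \<cdot> e'" using fk by force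
    then have "t \<cdot> k \<cdot> e' = f \<cdot> e'" using Comp_assoc[OF eh' e(2) t(1)] e'(3) by metis
    then have "t \<cdot> k = f" using epic_cancel[OF e'(2) eh'] Comp_closed[OF e(2) t(1)] f by metis
    then show ?thesis using t by blast
  qed
  moreover have "short_exact A k (j \<cdot> e)" using short_exact_iso_right[OF e ij] .
  moreover have "j \<cdot> e \<in> homs A P X" using Comp_closed e ij by metis
  moreover have "P \<in> C" using d(1) KP by (simp add: Gorenstein_sequence_def)
  moreover have "K \<in> Gorenstein A C" using Gorenstein_image[OF d(1) k] KP by simp
  ultimately show ?thesis using e(2) by blast
qed

end

theorem theorem3p3:
  fixes A :: "('o, 'm, 'z) precat_scheme" and C :: "'o set"
  assumes "abelian_category A"
    and "subcategory A C"
    and "Ext_orthogonal A C C"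
    and "generator_for A (projectives A) C"
  shows "(closed_under_products TYPE('i) A (right_perp1 A (Gorenstein A C)) \<and>
      closed_under_summands A (right_perp1 A (Gorenstein A C)) \<and>
      closed_under_extensions A (right_perp1 A (Gorenstein A C))) \<and>
    projectively_resolving A (right_perp1 A (Gorenstein A C)) \<and>
    injectively_coresolving A (right_perp1 A (Gorenstein A C))"
proof -
  interpret abelian_category A by fact
  have C: "C = projectives A"
    using orthogonal_generated_eq_projectives assms(2-4) by (simp add: subcategory_def)
  \<comment> \<open>Rewriting with \<open>C\<close> turns membership of the middle terms in
    \<open>C\<close> into projectivity, and the extension clause over \<open>C\<close> into the one
    over projectives.\<close>
  interpret syzygy_class A "Gorenstein A C"
    by unfold_locales
      (use Gorenstein_syzygy[of _ C] Gorenstein_cosyzygy[of _ C] C in simp_all)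
  show ?thesis
    unfolding projectively_resolving_def injectively_coresolving_def
    using closed_under_products_perp closed_under_summands_perp closed_under_extensions_perp
      subcategory_perp projectives_perp injectives_perp closed_under_kernels_of_epis_perp
      closed_under_cokernels_of_monos_perp by blast
qed

end
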